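(* Consider the setting described in the context, and assume A1–A5. Let the sequence of alternatives $f_n$ be consistent and let $f_{1n}$ be any inconsistent sequence of alternatives. Then for every $\alpha\in(0,1)$ and every sequence of tests $K_n$ generated by $T_n$ with $\alpha(K_n)=\alpha(1+o(1))$, $$\lim_{n\to\infty}\big(\beta(K_n,f_n)-\beta(K_n,f_n+f_{1n})\big)=0 .$$
   Context: Fix $\sigma>0$, $0<r<1/2$ and an orthonormal basis $(\phi_j)_{j\ge1}$ of $\mathbb{L}_2(0,1)$. For each $n$ one observes $dY_n(t)=f(t)\,dt+\sigma n^{-1/2}dw(t)$, equivalently $y_j=\theta_j+\sigma n^{-1/2}\xi_j$, $\theta_j=\int_0^1f\phi_j$, $\xi_j$ i.i.d. $N(0,1)$; $H_0:f=0$. Weights $\kappa_{nj}^2\ge0$, $\rho_n=\sum_j\kappa_{nj}^2$, $T_n(Y_n)=\sum_j\kappa_{nj}^2y_j^2-\sigma^2n^{-1}\rho_n$, $k_n=\sup\{k:\sum_{j<k}\kappa_{nj}^2\le\rho_n/2\}$, $\kappa_n^2=\kappa_{nk_n}^2$. Assumptions: (A1) $j\mapsto\kappa_{nj}^2$ decreasing; (A2) $C_1<\sigma^{-4}n^2\sum_j\kappa_{nj}^4<C_2$; (A3) $c_1n^{-2r}\le\rho_n\le c_2n^{-2r}$; (A4) $\exists C_1>0,\lambda>1$: $\kappa^2_{n,[(1+\delta)k_n]}<C_1(1+\delta)^{-\lambda}\kappa_n^2$ for all $\delta>0,n$; (A5) $\kappa_{n1}^2\asymp\kappa_n^2$ and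 for each $c>1$ there is $C>0$ with $\kappa^2_{n,[ck_n]}\ge C\kappa_n^2$. A test generated by $T_n$ rejects $H_0$ iff $T_n$ exceeds a threshold; $\alpha(K)$, $\beta(K,f)$ are type I and type II error probabilities. A sequence $f_n$ is consistent if for every $\alpha\in(0,1)$ and every sequence of tests $K_n$ generated by $T_n$ with $\alpha(K_n)=\alpha(1+o(1))$, $\limsup_n\beta(K_n,f_n)<1-\alpha$; it is inconsistent if for every sequence of tests $K_n$ generated by $T_n$, $\liminf_n(\alpha(K_n)+\beta(K_n,f_n))\ge1$. *)

theory Defs
  imports "HOL-Probability.Probability"
begin

definition L2_01 :: "(real \<Rightarrow> real) \<Rightarrow> bool" where
  "L2_01 f \<longleftrightarrow> f \<in> borel_measurable lborel \<and> set_integrable lborel {0..1} (\<lambda>t. (f t)\<^sup>2)"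

definition ip01 :: "(real \<Rightarrow> real) \<Rightarrow> (real \<Rightarrow> real) \<Rightarrow> real" where
  "ip01 f g = (LINT t:{0..1}|lborel. f t * g t)"

definition orthonormal_basis_01 :: "(nat \<Rightarrow> real \<Rightarrow> real) \<Rightarrow> bool" where
  "orthonormal_basis_01 \<phi> \<longleftrightarrow>
     (\<forall>j\<ge>1. L2_01 (\<phi> j)) \<and>
     (\<forall>i\<ge>1. \<forall>j\<ge>1. ip01 (\<phi> i) (\<phi> j) = (if i = j then 1 else 0)) \<and>
     (\<forall>f. L2_01 f \<longrightarrow> (\<forall>j\<ge>1. ip01 f (\<phi> j) = 0) \<longrightarrow> ip01 f f = 0)"

definition coef :: "(nat \<Rightarrow> real \<Rightarrow> real) \<Rightarrow> (real \<Rightarrow> real) \<Rightarrow> nat \<Rightarrow> real" where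
  "coef \<phi> f j = ip01 f (\<phi> j)"

text \<open>Law of the i.i.d. N(0,1) noise sequence (xi j) (only indices j >= 1 are used).\<close>
definition Xi :: "(nat \<Rightarrow> real) measure" where
  "Xi = (\<Pi>\<^sub>M j\<in>(UNIV::nat set). density lborel std_normal_density)"

text \<open>w n j stands for kappa_{nj}^2 (j >= 1).  rho_n = sum_j kappa_{nj}^2.\<close>
definition rho :: "(nat \<Rightarrow> nat \<Rightarrow> real) \<Rightarrow> nat \<Rightarrow> real" where
  "rho w n = (\<Sum>j. w n (Suc j))"

definition kn :: "(nat \<Rightarrow> nat \<Rightarrow> real) \<Rightarrow> nat \<Rightarrow> nat" where
  "kn w n = Sup {k. (\<Sum>j\<in>{1..<k}. w n j) \<le> rho w n / 2}"

definition kapn :: "(nat \<Rightarrow> nat \<Rightarrow> real) \<Rightarrow> nat \<Rightarrow> real" where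
  "kapn w n = w n (kn w n)"

text \<open>Test statistic T_n(Y_n) as a function of the noise xi, for coefficient sequence theta,
  with y_j = theta_j + sigma n^{-1/2} xi_j.\<close>
definition Tstat :: "(nat \<Rightarrow> nat \<Rightarrow> real) \<Rightarrow> real \<Rightarrow> nat \<Rightarrow> (nat \<Rightarrow> real) \<Rightarrow> (nat \<Rightarrow> real) \<Rightarrow> real" where
  "Tstat w \<sigma> n \<theta> \<xi> =
     (\<Sum>j. w n (Suc j) * (\<theta> (Suc j) + \<sigma> / sqrt (real n) * \<xi> (Suc j))\<^sup>2) - \<sigma>\<^sup>2 / real n * rho w n"

text \<open>Test K generated by T_n with threshold t: reject H0 iff T_n > t.
  Type I error alpha(K) and type II error beta(K,f).\<close>
definition type1 :: "(nat \<Rightarrow> nat \<Rightarrow> real) \<Rightarrow> real \<Rightarrow> nat \<Rightarrow> real \<Rightarrow> real" where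
  "type1 w \<sigma> n t = measure Xi {\<xi> \<in> space Xi. Tstat w \<sigma> n (\<lambda>_. 0) \<xi> > t}"

definition type2 :: "(nat \<Rightarrow> real \<Rightarrow> real) \<Rightarrow> (nat \<Rightarrow> nat \<Rightarrow> real) \<Rightarrow> real \<Rightarrow> nat \<Rightarrow> real
    \<Rightarrow> (real \<Rightarrow> real) \<Rightarrow> real" where
  "type2 \<phi> w \<sigma> n t f = measure Xi {\<xi> \<in> space Xi. Tstat w \<sigma> n (coef \<phi> f) \<xi> \<le> t}"

definition consistent_alt :: "(nat \<Rightarrow> real \<Rightarrow> real) \<Rightarrow> (nat \<Rightarrow> nat \<Rightarrow> real) \<Rightarrow> real
    \<Rightarrow> (nat \<Rightarrow> real \<Rightarrow> real) \<Rightarrow> bool" where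
  "consistent_alt \<phi> w \<sigma> f \<longleftrightarrow>
     (\<forall>\<alpha>. 0 < \<alpha> \<and> \<alpha> < 1 \<longrightarrow>
       (\<forall>t :: nat \<Rightarrow> real. (\<lambda>n. type1 w \<sigma> n (t n)) \<longlonglongrightarrow> \<alpha> \<longrightarrow>
          limsup (\<lambda>n. ereal (type2 \<phi> w \<sigma> n (t n) (f n))) < ereal (1 - \<alpha>)))"

definition inconsistent_alt :: "(nat \<Rightarrow> real \<Rightarrow> real) \<Rightarrow> (nat \<Rightarrow> nat \<Rightarrow> real) \<Rightarrow> real
    \<Rightarrow> (nat \<Rightarrow> real \<Rightarrow> real) \<Rightarrow> bool" where
  "inconsistent_alt \<phi> w \<sigma> f \<longleftrightarrow>
     (\<forall>t :: nat \<Rightarrow> real.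
        liminf (\<lambda>n. ereal (type1 w \<sigma> n (t n) + type2 \<phi> w \<sigma> n (t n) (f n))) \<ge> 1)"

end

theory Submission
  imports Defs
begin

text \<open>
  After rescaling, the statistic is \<open>Z + 2 L + D\<close> with \<open>Z = \<Sum>j. b\<^sub>j (\<xi>\<^sub>j\<^sup>2 - 1)\<close>,
  \<open>L = \<Sum>j. b\<^sub>j \<mu>\<^sub>j \<xi>\<^sub>j\<close> and the energy \<open>D = \<Sum>j. b\<^sub>j \<mu>\<^sub>j\<^sup>2\<close>.  The assumptions give
  \<open>b\<^sub>1 \<rightarrow> 0\<close> while \<open>\<Sum>j. b\<^sub>j\<^sup>2\<close> stays between positive constants.  Hence \<open>Z\<close> is tight, its
  characteristic function is at most \<open>exp (- u\<^sup>2 (\<Sum>j. b\<^sub>j\<^sup>2) / 2)\<close> on a growing range of \<open>u\<close>, so that it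
  does not concentrate on short intervals, and \<open>L\<close>, of variance at most \<open>b\<^sub>1 D\<close>, is negligible
  compared with \<open>max 1 D\<close>.

  If the energy of an alternative stayed above some \<open>d > 0\<close>, a threshold just above an interval of
  length \<open>d / 2\<close> carrying a fixed share of the mass of \<open>Z\<close> would separate it from the hypothesis;
  so inconsistent alternatives have energy tending to \<open>0\<close>.  Adding such an alternative changes a
  bounded energy by \<open>o(1)\<close>, and the type II error by \<open>o(1)\<close> since \<open>Z\<close> does not concentrate; where the
  energy is large, both type II errors are small.
\<close>

section \<open>Independent series and concentration\<close>

lemma abs_mult_le_sum_squares: "\<bar>x * y\<bar> \<le> x\<^sup>2 + y\<^sup>2" for x y :: real
  using sum_squares_bound[of "\<bar>x\<bar>" "\<bar>y\<bar>"] abs_ge_zero[of "x * y"]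
  unfolding abs_mult power2_abs by linarith

text \<open>The square expands into a double sum. Distinct terms are independent and centred, so
  their products have expectation 0 and only the diagonal survives.\<close>

lemma (in prob_space) expectation_sum_power2_indep:
  fixes Y :: "nat \<Rightarrow> 'a \<Rightarrow> real"
  assumes indep: "indep_vars (\<lambda>_. borel) Y UNIV"
    and sq: "\<And>j. integrable M (\<lambda>x. (Y j x)\<^sup>2)"
    and mean: "\<And>j. expectation (Y j) = 0"
  shows "integrable M (\<lambda>x. (\<Sum>j<N. Y j x)\<^sup>2)"
    and "expectation (\<lambda>x. (\<Sum>j<N. Y j x)\<^sup>2) = (\<Sum>j<N. expectation (\<lambda>x. (Y j x)\<^sup>2))"
proof -
  have rv[measurable]: "random_variable borel (Y j)" for j
    using indep unfolding indep_vars_def2 by simp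
  have int[simp]: "integrable M (Y j)" for j
    by (rule square_integrable_imp_integrable[OF _ sq]) simp
  have iv: "indep_var borel (Y i) borel (Y j)" if "i \<noteq> j" for i j
    using indep_vars_sum[of "{j}" i Y] indep_vars_subset[OF indep, of "{i, j}"] that by simp
  have prod_int: "integrable M (\<lambda>x. Y i x * Y j x)" for i j
    using indep_var_integrable[OF iv int int] sq[of i] by (cases "i = j") (auto simp: power2_eq_square)
  have prod_E: "expectation (\<lambda>x. Y i x * Y j x) = (if i = j then expectation (\<lambda>x. (Y j x)\<^sup>2) else 0)" for i j
    using indep_var_lebesgue_integral[OF iv int int] by (simp add: power2_eq_square mean)
  have eq: "(\<Sum>j<N. Y j x)\<^sup>2 = (\<Sum>i<N. \<Sum>j<N. Y i x * Y j x)" for x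
    by (simp add: power2_eq_square sum_product)
  show "integrable M (\<lambda>x. (\<Sum>j<N. Y j x)\<^sup>2)"
    unfolding eq by (intro Bochner_Integration.integrable_sum prod_int)
  show "expectation (\<lambda>x. (\<Sum>j<N. Y j x)\<^sup>2) = (\<Sum>j<N. expectation (\<lambda>x. (Y j x)\<^sup>2))"
    unfolding eq by (simp add: Bochner_Integration.integral_sum prod_int prod_E)
qed

text \<open>Chebyshev's inequality for an infinite series. The second moments of the partial sums
  are at most the sum of the \<open>v j\<close>, and Fatou's lemma carries this bound to the almost
  sure limit. Working in \<open>ennreal\<close> avoids having to know beforehand that the limit is
  square integrable.\<close>

lemma (in prob_space) prob_abs_suminf_indep_ge_le:
  fixes Y :: "nat \<Rightarrow> 'a \<Rightarrow> real"
  assumes indep: "indep_vars (\<lambda>_. borel) Y UNIV"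
    and sq: "\<And>j. integrable M (\<lambda>x. (Y j x)\<^sup>2)"
    and mean: "\<And>j. expectation (Y j) = 0"
    and var: "\<And>j. expectation (\<lambda>x. (Y j x)\<^sup>2) = v j"
    and v: "summable v"
    and conv: "AE x in M. summable (\<lambda>j. Y j x)"
    and a: "a > 0"
  shows "prob {x \<in> space M. a \<le> \<bar>\<Sum>j. Y j x\<bar>} \<le> (\<Sum>j. v j) / a\<^sup>2"
proof -
  have rv[measurable]: "random_variable borel (Y j)" for j
    using indep unfolding indep_vars_def2 by simp
  have v0: "0 \<le> v j" for j
    unfolding var[symmetric] by simp
  let ?S = "\<lambda>x. \<Sum>j. Y j x"
  have "(\<integral>\<^sup>+ x. ennreal ((?S x)\<^sup>2) \<partial>M) = (\<integral>\<^sup>+ x. liminf (\<lambda>N. ennreal ((\<Sum>j<N. Y j x)\<^sup>2)) \<partial>M)"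
  proof (rule nn_integral_cong_AE, use conv in eventually_elim)
    case (elim x)
    then have "(\<lambda>N. ennreal ((\<Sum>j<N. Y j x)\<^sup>2)) \<longlonglongrightarrow> ennreal ((?S x)\<^sup>2)"
      by (intro tendsto_intros tendsto_ennrealI summable_LIMSEQ)
    then show ?case
      by (rule lim_imp_Liminf[OF trivial_limit_sequentially, symmetric])
  qed
  also have "\<dots> \<le> liminf (\<lambda>N. \<integral>\<^sup>+ x. ennreal ((\<Sum>j<N. Y j x)\<^sup>2) \<partial>M)"
    by (intro nn_integral_liminf) auto
  also have "\<dots> \<le> ennreal (\<Sum>j. v j)"
  proof (rule Liminf_le, simp, intro always_eventually allI)
    fix N
    have "(\<integral>\<^sup>+ x. ennreal ((\<Sum>j<N. Y j x)\<^sup>2) \<partial>M) = ennreal (\<Sum>j<N. v j)"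
      using expectation_sum_power2_indep[OF indep sq mean, of N]
      by (subst nn_integral_eq_integral) (auto simp: var)
    also have "\<dots> \<le> ennreal (\<Sum>j. v j)"
      by (intro ennreal_leI sum_le_suminf v) (auto simp: v0)
    finally show "(\<integral>\<^sup>+ x. ennreal ((\<Sum>j<N. Y j x)\<^sup>2) \<partial>M) \<le> ennreal (\<Sum>j. v j)" .
  qed
  finally have m2: "(\<integral>\<^sup>+ x. ennreal ((?S x)\<^sup>2) \<partial>M) \<le> ennreal (\<Sum>j. v j)" .
  \<comment> \<open>Markov's inequality for the square of the limit.\<close>
  have "ennreal (a\<^sup>2) * emeasure M {x \<in> space M. a \<le> \<bar>?S x\<bar>}
      = (\<integral>\<^sup>+ x. ennreal (a\<^sup>2) * indicator {x \<in> space M. a \<le> \<bar>?S x\<bar>} x \<partial>M)"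
    by (subst nn_integral_cmult_indicator) auto
  also have "\<dots> \<le> (\<integral>\<^sup>+ x. ennreal ((?S x)\<^sup>2) \<partial>M)"
    using a by (intro nn_integral_mono)
      (auto simp: indicator_def abs_le_square_iff[symmetric] intro!: ennreal_leI)
  also note m2
  finally have "ennreal (a\<^sup>2 * prob {x \<in> space M. a \<le> \<bar>?S x\<bar>}) \<le> ennreal (\<Sum>j. v j)"
    by (simp add: emeasure_eq_measure ennreal_mult)
  then have "a\<^sup>2 * prob {x \<in> space M. a \<le> \<bar>?S x\<bar>} \<le> (\<Sum>j. v j)"
    using suminf_nonneg[OF v] v0 by simp
  then show ?thesis
    using a by (simp add: field_simps)
qed

text \<open>By Tonelli the expectation of the whole sum is the sum of the expectations, hence
  finite, and a nonnegative variable with finite expectation is almost surely finite.\<close>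

lemma (in prob_space) AE_summable_of_expectation:
  fixes Y :: "nat \<Rightarrow> 'a \<Rightarrow> real"
  assumes int: "\<And>j. integrable M (Y j)"
    and nn: "\<And>j x. 0 \<le> Y j x"
    and s: "summable (\<lambda>j. expectation (Y j))"
  shows "AE x in M. summable (\<lambda>j. Y j x)"
proof -
  have [measurable]: "Y j \<in> borel_measurable M" for j
    using int by auto
  have "(\<integral>\<^sup>+ x. (\<Sum>j. ennreal (Y j x)) \<partial>M) = (\<Sum>j. \<integral>\<^sup>+ x. ennreal (Y j x) \<partial>M)"
    by (intro nn_integral_suminf) auto
  also have "\<dots> = (\<Sum>j. ennreal (expectation (Y j)))"
    by (subst nn_integral_eq_integral) (auto simp: int nn)
  also have "\<dots> = ennreal (\<Sum>j. expectation (Y j))"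
    by (intro suminf_ennreal2 s) (auto simp: nn)
  finally have "(\<integral>\<^sup>+ x. (\<Sum>j. ennreal (Y j x)) \<partial>M) \<noteq> \<infinity>"
    by simp
  then have "AE x in M. (\<Sum>j. ennreal (Y j x)) \<noteq> \<infinity>"
    by (intro nn_integral_noteq_infinite) auto
  then show ?thesis
    by eventually_elim (auto intro!: summable_suminf_not_top simp: nn)
qed

text \<open>The indicator of the interval is dominated by a Gaussian kernel, which is itself the
  characteristic function of a Gaussian variable, so Fubini applies.\<close>

lemma (in real_distribution) concentration_le_char:
  assumes e: "e > 0"
  shows "prob {x - e..x + e} \<le> 2 * (\<integral>g. cmod (char M (g / e)) \<partial>std_normal_distribution)"
proof -
  interpret N: real_distribution std_normal_distribution
    by (rule real_dist_normal_dist)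
  interpret P: pair_prob_space M std_normal_distribution ..
  let ?F = "\<lambda>y g. iexp (g * ((y - x) / e))"
  have meas[measurable]: "(\<lambda>(y, g). ?F y g) \<in> borel_measurable (M \<Otimes>\<^sub>M std_normal_distribution)"
    by measurable
  have int: "integrable (M \<Otimes>\<^sub>M std_normal_distribution) (\<lambda>(y, g). ?F y g)"
    by (rule P.integrable_const_bound[where B = 1]) (auto simp: split_beta')
  let ?h = "\<lambda>y. exp (- (((y - x) / e)\<^sup>2) / 2)"
  have inth: "integrable M ?h"
    by (rule integrable_const_bound[where B = 1]) auto
  have "prob {x - e..x + e} = (\<integral>y. indicator {x - e..x + e} y \<partial>M)"
    by simp
  also have "\<dots> \<le> (\<integral>y. 2 * ?h y \<partial>M)"
  proof (rule integral_mono)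
    show "integrable M (indicator {x - e..x + e} :: real \<Rightarrow> real)"
      by (intro integrable_real_indicator) (auto simp: emeasure_eq_measure)
    show "integrable M (\<lambda>y. 2 * ?h y)"
      using inth by simp
    \<comment> \<open>On the interval \<open>(y - x) / e\<close> has modulus at most 1, so the
      kernel is at least \<open>exp (- (1 / 2))\<close>, which exceeds one half.\<close>
    show "indicator {x - e..x + e} y \<le> 2 * ?h y" for y
    proof (cases "y \<in> {x - e..x + e}")
      case True
      then have "\<bar>(y - x) / e\<bar> \<le> 1"
        using e by (auto simp: abs_le_iff field_simps)
      then have "((y - x) / e)\<^sup>2 \<le> 1"
        by (simp add: abs_square_le_1)
      then have "exp (- (1 / 2)) \<le> ?h y"
        by simp
      moreover have "1 \<le> 2 * exp (- (1 / 2 :: real))"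
        using exp_half_le2 by (simp add: exp_minus field_simps)
      ultimately have "1 \<le> 2 * ?h y"
        by linarith
      then show ?thesis
        using True by (simp add: indicator_def)
    qed simp
  qed
  also have "\<dots> = 2 * (\<integral>y. ?h y \<partial>M)"
    by simp
  also have "(\<integral>y. ?h y \<partial>M) = Re (\<integral>y. complex_of_real (?h y) \<partial>M)"
    by simp
  also have "(\<integral>y. complex_of_real (?h y) \<partial>M) = (\<integral>y. (\<integral>g. ?F y g \<partial>std_normal_distribution) \<partial>M)"
  proof (rule Bochner_Integration.integral_cong[OF refl])
    fix y
    show "complex_of_real (?h y) = (\<integral>g. ?F y g \<partial>std_normal_distribution)"
      using fun_cong[OF char_std_normal_distribution, of "(y - x) / e"]
      by (simp add: char_def mult.commute)
  qed
  also have "\<dots> = (\<integral>g. (\<integral>y. ?F y g \<partial>M) \<partial>std_normal_distribution)"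
    by (rule P.Fubini_integral[symmetric, OF int])
  also have "Re \<dots> \<le> cmod \<dots>"
    by (rule complex_Re_le_cmod)
  also have "\<dots> \<le> (\<integral>g. cmod (\<integral>y. ?F y g \<partial>M) \<partial>std_normal_distribution)"
    by (rule integral_norm_bound)
  also have "\<dots> = (\<integral>g. cmod (char M (g / e)) \<partial>std_normal_distribution)"
  proof (rule Bochner_Integration.integral_cong[OF refl])
    fix g
    \<comment> \<open>The centre \<open>x\<close> enters only through a factor of modulus one, so
      the bound is the same for all intervals of the given length.\<close>
    have "?F y g = iexp (- (g * x / e)) * iexp (g / e * y)" for y
      by (simp add: exp_add[symmetric] algebra_simps diff_divide_distrib)
    then have "(\<integral>y. ?F y g \<partial>M) = iexp (- (g * x / e)) * char M (g / e)"
      by (simp add: char_def)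
    then show "cmod (\<integral>y. ?F y g \<partial>M) = cmod (char M (g / e))"
      by (simp add: norm_mult)
  qed
  finally show ?thesis by simp
qed

section \<open>Weighted quadratic forms in Gaussian noise\<close>

text \<open>The centred square has mean 0 and variance 2, so its characteristic function is
  \<open>1 - u^2\<close> up to a cubic error. For small \<open>u\<close> that error is at most
  \<open>u^2 / 2\<close>, and \<open>1 - u^2 / 2\<close> is at most
  \<open>exp (- u^2 / 2)\<close>.\<close>

lemma char_chi_square_le:
  obtains s where "s > 0"
    "\<And>u. \<bar>u\<bar> \<le> s \<Longrightarrow> cmod (char (distr std_normal_distribution borel (\<lambda>x. x\<^sup>2 - 1)) u) \<le> exp (- u\<^sup>2 / 2)"
proof -
  interpret N: real_distribution std_normal_distribution
    by (rule real_dist_normal_dist)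
  note [simp] = integrable_std_normal_distribution_moment
  have E2: "N.expectation (\<lambda>x. x\<^sup>2) = 1" and E4: "N.expectation (\<lambda>x. x ^ 4) = 3"
    using std_normal_distribution_even_moments(1)[of 1] std_normal_distribution_even_moments(1)[of 2]
    by (simp_all add: fact_numeral)
  have sq: "(x\<^sup>2 - 1)\<^sup>2 = x ^ 4 - 2 * x\<^sup>2 + 1" for x :: real
    by (simp add: power2_eq_square algebra_simps power4_eq_xxxx)
  have cube: "(x\<^sup>2 - 1) ^ 3 = x ^ 6 - 3 * x ^ 4 + 3 * x\<^sup>2 - 1" for x :: real
    by (simp add: eval_nat_numeral algebra_simps)
  have int3: "integrable std_normal_distribution (\<lambda>x. \<bar>x\<^sup>2 - 1\<bar> ^ 3)"
    unfolding power_abs[symmetric] cube by (intro integrable_abs) simp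
  define K where "K = N.expectation (\<lambda>x. \<bar>x\<^sup>2 - 1\<bar> ^ 3)"
  have K0: "K \<ge> 0"
    unfolding K_def by simp
  \<comment> \<open>The bound 1 keeps \<open>1 - u^2\<close> nonnegative; the other one makes the
    error \<open>u^2 / 6 * (|u| * K)\<close> at most \<open>u^2 / 2\<close>. The summand 1 in the
    denominator covers \<open>K = 0\<close>.\<close>
  define s where "s = min 1 (3 / (K + 1))"
  have s: "s > 0" "s \<le> 1" "s * K \<le> 3"
    using K0 by (auto simp: s_def min_def field_simps)
  have "cmod (char (distr std_normal_distribution borel (\<lambda>x. x\<^sup>2 - 1)) u) \<le> exp (- u\<^sup>2 / 2)"
    if u: "\<bar>u\<bar> \<le> s" for u
  proof -
    let ?c = "char (distr std_normal_distribution borel (\<lambda>x. x\<^sup>2 - 1)) u"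
    have u1: "u\<^sup>2 \<le> 1"
      using u s by (simp add: abs_square_le_1)
    have "cmod (?c - (1 - u\<^sup>2 * 2 / 2))
      \<le> (u\<^sup>2 / 6) * N.expectation (\<lambda>x. min (6 * (x\<^sup>2 - 1)\<^sup>2) (\<bar>u\<bar> * \<bar>x\<^sup>2 - 1\<bar> ^ 3))"
      using E2 E4 by (intro N.char_approx3') (simp_all add: sq N.prob_space[simplified])
    also have "\<dots> \<le> (u\<^sup>2 / 6) * (\<bar>u\<bar> * K)"
    proof (intro mult_left_mono)
      have "N.expectation (\<lambda>x. min (6 * (x\<^sup>2 - 1)\<^sup>2) (\<bar>u\<bar> * \<bar>x\<^sup>2 - 1\<bar> ^ 3))
        \<le> N.expectation (\<lambda>x. \<bar>u\<bar> * \<bar>x\<^sup>2 - 1\<bar> ^ 3)"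
        using int3 by (intro integral_mono integrable_min) (auto simp: sq)
      then show "N.expectation (\<lambda>x. min (6 * (x\<^sup>2 - 1)\<^sup>2) (\<bar>u\<bar> * \<bar>x\<^sup>2 - 1\<bar> ^ 3)) \<le> \<bar>u\<bar> * K"
        by (simp add: K_def)
    qed simp
    also have "\<dots> \<le> (u\<^sup>2 / 6) * 3"
      using mult_right_mono[OF u K0] s by (intro mult_left_mono) auto
    finally have a: "cmod (?c - of_real (1 - u\<^sup>2)) \<le> u\<^sup>2 / 2"
      by simp
    have "cmod ?c \<le> cmod (?c - of_real (1 - u\<^sup>2)) + cmod (of_real (1 - u\<^sup>2))"
      by (metis diff_add_cancel norm_triangle_ineq)
    also have "\<dots> \<le> u\<^sup>2 / 2 + (1 - u\<^sup>2)"
      using a u1 by (simp only: norm_of_real)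
    also have "\<dots> \<le> exp (- u\<^sup>2 / 2)"
      using exp_ge_add_one_self[of "- u\<^sup>2 / 2"] by simp
    finally show ?thesis .
  qed
  with s(1) show ?thesis
    by (rule that)
qed

text \<open>Bounding the normal density by its value at 0 leaves an unnormalised Gaussian density of
  variance \<open>1 / v\<close>, whose integral is known.\<close>

lemma std_normal_expectation_exp_le:
  assumes v: "v > 0"
  shows "(\<integral>g. exp (- (v * g\<^sup>2) / 2) \<partial>std_normal_distribution) \<le> 1 / sqrt v"
proof -
  have "(\<integral>g. exp (- (v * g\<^sup>2) / 2) \<partial>std_normal_distribution)
      = (\<integral>g. std_normal_density g * exp (- (v * g\<^sup>2) / 2) \<partial>lborel)"
    by (subst integral_density) auto
  also have "\<dots> \<le> (\<integral>g. 1 / sqrt v * normal_density 0 (1 / sqrt v) g \<partial>lborel)"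
  proof (rule integral_mono)
    show "integrable lborel (\<lambda>g. 1 / sqrt v * normal_density 0 (1 / sqrt v) g)"
      using v by simp
    show le: "std_normal_density g * exp (- (v * g\<^sup>2) / 2) \<le> 1 / sqrt v * normal_density 0 (1 / sqrt v) g" for g
    proof -
      have "std_normal_density g \<le> 1 / sqrt (2 * pi)"
        by (auto simp: std_normal_density_def intro!: divide_right_mono)
      then have "std_normal_density g * exp (- (v * g\<^sup>2) / 2) \<le> 1 / sqrt (2 * pi) * exp (- (v * g\<^sup>2) / 2)"
        by (intro mult_right_mono) auto
      also have "\<dots> = 1 / sqrt v * normal_density 0 (1 / sqrt v) g"
        using v by (simp add: normal_density_def power_divide real_sqrt_divide field_simps)
      finally show ?thesis .
    qed
    show "integrable lborel (\<lambda>g. std_normal_density g * exp (- (v * g\<^sup>2) / 2))"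
      by (rule Bochner_Integration.integrable_bound[of lborel "std_normal_density"])
         (use v in \<open>auto simp: abs_mult intro!: mult_left_le\<close>)
  qed
  also have "\<dots> = 1 / sqrt v"
    using v by simp
  finally show ?thesis .
qed

section \<open>Quadratic and linear forms in a standard Gaussian sequence\<close>

locale gaussian_noise = prob_space M for M :: "'a measure" +
  fixes X :: "nat \<Rightarrow> 'a \<Rightarrow> real"
  assumes indep_X: "indep_vars (\<lambda>_. borel) X UNIV"
    and distr_X: "\<And>j. distr M borel (X j) = std_normal_distribution"
begin

definition chi_form :: "(nat \<Rightarrow> real) \<Rightarrow> 'a \<Rightarrow> real" where
  "chi_form b x = (\<Sum>j. b j * ((X j x)\<^sup>2 - 1))"

definition lin_form :: "(nat \<Rightarrow> real) \<Rightarrow> (nat \<Rightarrow> real) \<Rightarrow> 'a \<Rightarrow> real" where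
  "lin_form b \<mu> x = (\<Sum>j. b j * \<mu> j * X j x)"

text \<open>The centring is subtracted once, after the summation, to match the shape of
  \<open>Tstat\<close>; the termwise centred series is \<open>chi_form\<close>.\<close>

definition shifted_form :: "(nat \<Rightarrow> real) \<Rightarrow> (nat \<Rightarrow> real) \<Rightarrow> 'a \<Rightarrow> real" where
  "shifted_form b \<mu> x = (\<Sum>j. b j * (\<mu> j + X j x)\<^sup>2) - (\<Sum>j. b j)"

lemma X_measurable[measurable]: "X j \<in> borel_measurable M"
  using indep_X unfolding indep_vars_def2 by simp

lemma forms_measurable[measurable]:
  "chi_form b \<in> borel_measurable M" "lin_form b \<mu> \<in> borel_measurable M"
  "shifted_form b \<mu> \<in> borel_measurable M"
  unfolding chi_form_def[abs_def] lin_form_def[abs_def] shifted_form_def[abs_def] by measurable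

lemma expectation_X:
  fixes h :: "real \<Rightarrow> real"
  assumes "h \<in> borel_measurable borel"
  shows "expectation (\<lambda>x. h (X j x)) = (\<integral>g. h g \<partial>std_normal_distribution)"
  using assms by (simp add: distr_X[of j, symmetric] integral_distr)

lemma integrable_X_iff:
  fixes h :: "real \<Rightarrow> real"
  assumes "h \<in> borel_measurable borel"
  shows "integrable M (\<lambda>x. h (X j x)) \<longleftrightarrow> integrable std_normal_distribution h"
  using assms by (simp add: distr_X[of j, symmetric] integrable_distr_eq)

lemma moments_X:
  "integrable M (\<lambda>x. X j x ^ k)" "integrable M (X j)" "expectation (X j) = 0"
  "expectation (\<lambda>x. (X j x)\<^sup>2) = 1" "expectation (\<lambda>x. X j x ^ 4) = 3"
  using integrable_X_iff[of "\<lambda>x. x ^ k" j] integrable_X_iff[of "\<lambda>x. x ^ 1" j]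
    expectation_X[of "\<lambda>x. x ^ 1" j] expectation_X[of "\<lambda>x. x ^ 2" j] expectation_X[of "\<lambda>x. x ^ 4" j]
    integral_std_normal_distribution_moment_odd[of 1] integrable_std_normal_distribution_moment[of 1]
    std_normal_distribution_even_moments(1)[of 1] std_normal_distribution_even_moments(1)[of 2]
  by (simp_all add: fact_numeral integrable_std_normal_distribution_moment del: power_one_right)

end

text \<open>\<open>b 0\<close> acts as the largest weight. It controls the variance of the linear
  form and the range of \<open>u\<close> on which the characteristic function of the quadratic form
  decays like a Gaussian one.\<close>

locale weighted_gaussian_noise = gaussian_noise +
  fixes b :: "nat \<Rightarrow> real"
  assumes b_nonneg: "\<And>j. 0 \<le> b j" and b_summable: "summable b" and b_le: "\<And>j. b j \<le> b 0"
begin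

lemma b_sq_summable: "summable (\<lambda>j. (b j)\<^sup>2)"
  by (rule summable_comparison_test[OF _ summable_mult[OF b_summable, of "b 0"]])
     (auto simp: power2_eq_square b_nonneg intro!: mult_right_mono b_le)

lemma AE_summable_square: "AE x in M. summable (\<lambda>j. b j * (X j x)\<^sup>2)"
  by (rule AE_summable_of_expectation) (auto simp: moments_X b_nonneg b_summable)

lemma AE_summable_centered: "AE x in M. summable (\<lambda>j. b j * ((X j x)\<^sup>2 - 1))"
  using AE_summable_square
  by eventually_elim (simp add: right_diff_distrib summable_diff b_summable)

text \<open>The product is dominated by the sum of the two squares. The second sequence may also be
  a realisation of the noise whose weighted squares are summable.\<close>

lemma summable_cross:
  assumes "summable (\<lambda>j. b j * (\<mu> j)\<^sup>2)" "summable (\<lambda>j. b j * (\<nu> j)\<^sup>2)"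
  shows "summable (\<lambda>j. b j * \<mu> j * \<nu> j)"
proof (rule summable_comparison_test[OF _ summable_add[OF assms]], intro exI allI impI)
  fix j
  from mult_left_mono[OF abs_mult_le_sum_squares[of "\<mu> j" "\<nu> j"] b_nonneg[of j]]
  show "norm (b j * \<mu> j * \<nu> j) \<le> b j * (\<mu> j)\<^sup>2 + b j * (\<nu> j)\<^sup>2"
    by (simp add: abs_mult b_nonneg algebra_simps)
qed

text \<open>Expand the square. Splitting the series is legitimate only where each of the three parts
  converges, which holds almost surely.\<close>

lemma AE_shifted_form_eq:
  assumes \<mu>: "summable (\<lambda>j. b j * (\<mu> j)\<^sup>2)"
  shows "AE x in M. shifted_form b \<mu> x = chi_form b x + 2 * lin_form b \<mu> x + (\<Sum>j. b j * (\<mu> j)\<^sup>2)"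
  using AE_summable_square
proof eventually_elim
  case (elim x)
  note c = summable_cross[OF \<mu> elim]
  have "(\<lambda>j. b j * (\<mu> j + X j x)\<^sup>2) = (\<lambda>j. b j * (\<mu> j)\<^sup>2 + 2 * (b j * \<mu> j * X j x) + b j * (X j x)\<^sup>2)"
    by (simp add: power2_sum algebra_simps)
  then show ?case
    using elim \<mu> c b_summable
    by (simp add: shifted_form_def chi_form_def lin_form_def right_diff_distrib suminf_add[symmetric]
        suminf_diff[symmetric] suminf_mult summable_add summable_mult)
qed

lemma prob_chi_form_ge_le:
  assumes a: "a > 0"
  shows "prob {x \<in> space M. a \<le> \<bar>chi_form b x\<bar>} \<le> 2 * (\<Sum>j. (b j)\<^sup>2) / a\<^sup>2"
proof -
  have sq: "(b j * (y\<^sup>2 - 1))\<^sup>2 = (b j)\<^sup>2 * (y ^ 4 - 2 * y\<^sup>2 + 1)" for j and y :: real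
    by (simp add: power2_eq_square algebra_simps power4_eq_xxxx)
  have "prob {x \<in> space M. a \<le> \<bar>\<Sum>j. b j * ((X j x)\<^sup>2 - 1)\<bar>} \<le> (\<Sum>j. 2 * (b j)\<^sup>2) / a\<^sup>2"
  proof (rule prob_abs_suminf_indep_ge_le[OF _ _ _ _ _ AE_summable_centered a])
    show "indep_vars (\<lambda>_. borel) (\<lambda>j x. b j * ((X j x)\<^sup>2 - 1)) UNIV"
      by (rule indep_vars_compose2[OF indep_X, where Y = "\<lambda>j y. b j * (y\<^sup>2 - 1)"]) auto
    show "integrable M (\<lambda>x. (b j * ((X j x)\<^sup>2 - 1))\<^sup>2)"
      "expectation (\<lambda>x. b j * ((X j x)\<^sup>2 - 1)) = 0"
      "expectation (\<lambda>x. (b j * ((X j x)\<^sup>2 - 1))\<^sup>2) = 2 * (b j)\<^sup>2" for j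
      by (simp_all add: sq moments_X prob_space)
    show "summable (\<lambda>j. 2 * (b j)\<^sup>2)"
      by (intro summable_mult b_sq_summable)
  qed
  then show ?thesis
    by (simp add: chi_form_def suminf_mult b_sq_summable)
qed

text \<open>The variance of the linear form is the sum of \<open>(b j * \<mu> j)^2\<close>, which is
  at most \<open>b 0\<close> times the energy of \<mu>; the claim is then Chebyshev's
  inequality.\<close>

lemma prob_lin_form_ge_le:
  assumes \<mu>: "summable (\<lambda>j. b j * (\<mu> j)\<^sup>2)" and a: "a > 0"
  shows "prob {x \<in> space M. a \<le> \<bar>lin_form b \<mu> x\<bar>} \<le> b 0 * (\<Sum>j. b j * (\<mu> j)\<^sup>2) / a\<^sup>2"
proof -
  have le: "(b j * \<mu> j)\<^sup>2 \<le> b 0 * (b j * (\<mu> j)\<^sup>2)" for j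
    using mult_right_mono[OF b_le[of j] mult_nonneg_nonneg[OF b_nonneg[of j] zero_le_power2[of "\<mu> j"]]]
    by (simp add: power2_eq_square algebra_simps)
  have s: "summable (\<lambda>j. (b j * \<mu> j)\<^sup>2)"
    by (rule summable_comparison_test[OF _ summable_mult[OF \<mu>, of "b 0"]]) (auto intro: le)
  have "prob {x \<in> space M. a \<le> \<bar>\<Sum>j. b j * \<mu> j * X j x\<bar>} \<le> (\<Sum>j. (b j * \<mu> j)\<^sup>2) / a\<^sup>2"
  proof (rule prob_abs_suminf_indep_ge_le[OF _ _ _ _ s _ a])
    show "indep_vars (\<lambda>_. borel) (\<lambda>j x. b j * \<mu> j * X j x) UNIV"
      by (rule indep_vars_compose2[OF indep_X, where Y = "\<lambda>j y. b j * \<mu> j * y"]) auto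
    show "AE x in M. summable (\<lambda>j. b j * \<mu> j * X j x)"
      using AE_summable_square by eventually_elim (rule summable_cross[OF \<mu>])
  qed (simp_all add: power_mult_distrib moments_X)
  also have "(\<Sum>j. (b j * \<mu> j)\<^sup>2) \<le> (\<Sum>j. b 0 * (b j * (\<mu> j)\<^sup>2))"
    by (intro suminf_le le s summable_mult \<mu>)
  finally show ?thesis
    by (simp add: lin_form_def suminf_mult \<mu> divide_right_mono)
qed

text \<open>For partial sums the characteristic function is a product over independent terms. Its
  factors are evaluated at \<open>u * b j\<close>, within the admissible range because
  \<open>b j\<close> is at most \<open>b 0\<close>. Dominated convergence gives the infinite
  sum.\<close>

lemma char_chi_form_le:
  assumes s: "\<And>u. \<bar>u\<bar> \<le> s \<Longrightarrow>
      cmod (char (distr std_normal_distribution borel (\<lambda>x. x\<^sup>2 - 1)) u) \<le> exp (- u\<^sup>2 / 2)"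
    and u: "\<bar>u\<bar> * b 0 \<le> s"
  shows "cmod (char (distr M borel (chi_form b)) u) \<le> exp (- u\<^sup>2 * (\<Sum>j. (b j)\<^sup>2) / 2)"
proof -
  let ?Y = "\<lambda>j x. b j * ((X j x)\<^sup>2 - 1)"
  have partial: "cmod (char (distr M borel (\<lambda>x. \<Sum>j<N. ?Y j x)) u) \<le> exp (- u\<^sup>2 * (\<Sum>j<N. (b j)\<^sup>2) / 2)" for N
  proof -
    have "indep_vars (\<lambda>_. borel) ?Y {..<N}"
      by (rule indep_vars_compose2[OF indep_vars_subset[OF indep_X], where Y = "\<lambda>j y. b j * (y\<^sup>2 - 1)"]) auto
    then have "char (distr M borel (\<lambda>x. \<Sum>j<N. ?Y j x)) u = (\<Prod>j<N. char (distr M borel (?Y j)) u)"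
      by (rule char_distr_sum)
    also have "cmod \<dots> = (\<Prod>j<N. cmod (char (distr M borel (?Y j)) u))"
      by (simp add: prod_norm)
    also have "\<dots> \<le> (\<Prod>j<N. exp (- (u * b j)\<^sup>2 / 2))"
    proof (intro prod_mono conjI norm_ge_zero)
      fix j
      have "char (distr M borel (?Y j)) u = char (distr std_normal_distribution borel (\<lambda>x. x\<^sup>2 - 1)) (u * b j)"
        unfolding char_def distr_X[of j, symmetric] by (simp add: integral_distr mult.assoc)
      moreover have "\<bar>u * b j\<bar> \<le> s"
        using mult_left_mono[OF b_le[of j], of "\<bar>u\<bar>"] u b_nonneg[of j] by (simp add: abs_mult)
      ultimately show "cmod (char (distr M borel (?Y j)) u) \<le> exp (- (u * b j)\<^sup>2 / 2)"
        using s by simp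
    qed
    also have "\<dots> = exp (- u\<^sup>2 * (\<Sum>j<N. (b j)\<^sup>2) / 2)"
      by (simp add: exp_sum[symmetric] power_mult_distrib sum_distrib_left sum_divide_distrib sum_negf)
    finally show ?thesis .
  qed
  have "(\<lambda>N. char (distr M borel (\<lambda>x. \<Sum>j<N. ?Y j x)) u) \<longlonglongrightarrow> char (distr M borel (chi_form b)) u"
    unfolding char_def
  proof (subst (1 2) integral_distr)
    show "(\<lambda>N. expectation (\<lambda>x. iexp (u * (\<Sum>j<N. ?Y j x)))) \<longlonglongrightarrow> expectation (\<lambda>x. iexp (u * chi_form b x))"
    proof (rule integral_dominated_convergence[where w = "\<lambda>_. 1"])
      show "AE x in M. (\<lambda>N. iexp (u * (\<Sum>j<N. ?Y j x))) \<longlonglongrightarrow> iexp (u * chi_form b x)"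
        using AE_summable_centered
        by eventually_elim (auto simp: chi_form_def simp del: of_real_sum of_real_mult
              intro!: isCont_tendsto_compose[OF isCont_iexp] tendsto_intros summable_LIMSEQ)
    qed auto
  qed auto
  then have "(\<lambda>N. cmod (char (distr M borel (\<lambda>x. \<Sum>j<N. ?Y j x)) u)) \<longlonglongrightarrow> cmod (char (distr M borel (chi_form b)) u)"
    by (rule tendsto_norm)
  moreover have "(\<lambda>N. exp (- u\<^sup>2 * (\<Sum>j<N. (b j)\<^sup>2) / 2)) \<longlonglongrightarrow> exp (- u\<^sup>2 * (\<Sum>j. (b j)\<^sup>2) / 2)"
    by (intro tendsto_intros summable_LIMSEQ b_sq_summable) simp
  ultimately show ?thesis
    by (rule LIMSEQ_le) (use partial in blast)
qed

text \<open>The Gaussian average of the characteristic function is split at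
  \<open>|g / e| * b 0 = s\<close>. Below, the Gaussian decay gives the first term; above, the
  trivial bound 1 is dominated by \<open>(g * b 0 / (e * s))^2\<close>, whose mean is the second
  term. The bound is small once \<open>e\<close> is small and \<open>b 0\<close> is small relative
  to \<open>e\<close>.\<close>

lemma prob_chi_form_near_le:
  assumes s: "s > 0" "\<And>u. \<bar>u\<bar> \<le> s \<Longrightarrow>
      cmod (char (distr std_normal_distribution borel (\<lambda>x. x\<^sup>2 - 1)) u) \<le> exp (- u\<^sup>2 / 2)"
    and e: "e > 0" and pos: "(\<Sum>j. (b j)\<^sup>2) > 0"
  shows "prob {x \<in> space M. \<bar>chi_form b x - y\<bar> \<le> e}
    \<le> 2 * (e / sqrt (\<Sum>j. (b j)\<^sup>2) + (b 0 / (e * s))\<^sup>2)"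
proof -
  interpret N: real_distribution std_normal_distribution
    by (rule real_dist_normal_dist)
  interpret D: real_distribution "distr M borel (chi_form b)"
    by (rule real_distribution_distr) simp
  let ?B = "\<Sum>j. (b j)\<^sup>2" and ?c = "char (distr M borel (chi_form b))"
  have E2: "N.expectation (\<lambda>x. x\<^sup>2) = 1"
    using std_normal_distribution_even_moments(1)[of 1] by (simp add: fact_numeral)
  have "prob {x \<in> space M. \<bar>chi_form b x - y\<bar> \<le> e} = D.prob {y - e..y + e}"
    by (subst measure_distr) (auto intro!: arg_cong[where f = prob] simp: abs_le_iff)
  also have "\<dots> \<le> 2 * (\<integral>g. cmod (?c (g / e)) \<partial>std_normal_distribution)"
    by (rule D.concentration_le_char[OF e])
  also have "(\<integral>g. cmod (?c (g / e)) \<partial>std_normal_distribution)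
      \<le> (\<integral>g. exp (- (?B / e\<^sup>2 * g\<^sup>2) / 2) + g\<^sup>2 * (b 0 / (e * s))\<^sup>2 \<partial>std_normal_distribution)"
  proof (rule integral_mono)
    show "integrable std_normal_distribution (\<lambda>g. cmod (?c (g / e)))"
      by (rule N.integrable_const_bound[where B = 1]) (auto simp: D.cmod_char_le_1)
    show "integrable std_normal_distribution (\<lambda>g. exp (- (?B / e\<^sup>2 * g\<^sup>2) / 2) + g\<^sup>2 * (b 0 / (e * s))\<^sup>2)"
      using pos
      by (intro Bochner_Integration.integrable_add integrable_mult_left integrable_std_normal_distribution_moment
          N.integrable_const_bound[where B = 1]) auto
    show "cmod (?c (g / e)) \<le> exp (- (?B / e\<^sup>2 * g\<^sup>2) / 2) + g\<^sup>2 * (b 0 / (e * s))\<^sup>2" for g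
    proof (cases "\<bar>g / e\<bar> * b 0 \<le> s")
      case True
      from char_chi_form_le[OF s(2) this] have "cmod (?c (g / e)) \<le> exp (- (?B / e\<^sup>2 * g\<^sup>2) / 2)"
        by (simp add: power_divide mult.commute)
      then show ?thesis
        by (simp add: add_increasing2)
    next
      case False
      then have "1 \<le> \<bar>g\<bar> * (b 0 / (e * s))"
        using e s(1) by (simp add: field_simps)
      then have "1 \<le> (\<bar>g\<bar> * (b 0 / (e * s)))\<^sup>2"
        by (rule one_le_power)
      then have "1 \<le> g\<^sup>2 * (b 0 / (e * s))\<^sup>2"
        by (simp only: power_mult_distrib power2_abs)
      then show ?thesis
        using D.cmod_char_le_1[of "g / e"] exp_ge_zero[of "- (?B / e\<^sup>2 * g\<^sup>2) / 2"] by linarith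
    qed
  qed
  also have "\<dots> = (\<integral>g. exp (- (?B / e\<^sup>2 * g\<^sup>2) / 2) \<partial>std_normal_distribution) + (b 0 / (e * s))\<^sup>2"
    using pos
    by (subst Bochner_Integration.integral_add)
       (auto simp: E2 integrable_std_normal_distribution_moment intro!: N.integrable_const_bound[where B = 1])
  also have "(\<integral>g. exp (- (?B / e\<^sup>2 * g\<^sup>2) / 2) \<partial>std_normal_distribution) \<le> 1 / sqrt (?B / e\<^sup>2)"
    using pos e by (intro std_normal_expectation_exp_le) simp
  also have "\<dots> = e / sqrt ?B"
    using e by (simp add: real_sqrt_divide)
  finally show ?thesis by simp
qed

end

section \<open>Energy of a shift and its effect on the distribution function\<close>

context weighted_gaussian_noise
begin

abbreviation energy :: "(nat \<Rightarrow> real) \<Rightarrow> real" where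
  "energy \<mu> \<equiv> \<Sum>j. b j * (\<mu> j)\<^sup>2"

lemma energy_nonneg: "summable (\<lambda>j. b j * (\<mu> j)\<^sup>2) \<Longrightarrow> 0 \<le> energy \<mu>"
  by (intro suminf_nonneg) (auto simp: b_nonneg)

text \<open>Young's inequality for the cross term. The free \<eta> serves two purposes later: a
  small value shows that a bounded energy hardly changes, the value 1/2 that a large energy stays
  large.\<close>

lemma energy_add:
  assumes \<mu>: "summable (\<lambda>j. b j * (\<mu> j)\<^sup>2)" and \<nu>: "summable (\<lambda>j. b j * (\<nu> j)\<^sup>2)" and \<eta>: "\<eta> > 0"
  shows "summable (\<lambda>j. b j * (\<mu> j + \<nu> j)\<^sup>2)"
    and "\<bar>energy (\<lambda>j. \<mu> j + \<nu> j) - energy \<mu>\<bar> \<le> \<eta> * energy \<mu> + (1 + 1 / \<eta>) * energy \<nu>"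
proof -
  note c = summable_cross[OF \<mu> \<nu>]
  have eq: "b j * (\<mu> j + \<nu> j)\<^sup>2 = b j * (\<mu> j)\<^sup>2 + 2 * (b j * \<mu> j * \<nu> j) + b j * (\<nu> j)\<^sup>2" for j
    by (simp add: power2_sum algebra_simps)
  show "summable (\<lambda>j. b j * (\<mu> j + \<nu> j)\<^sup>2)"
    unfolding eq by (intro summable_add summable_mult \<mu> \<nu> c)
  have "energy (\<lambda>j. \<mu> j + \<nu> j) = energy \<mu> + 2 * (\<Sum>j. b j * \<mu> j * \<nu> j) + energy \<nu>"
    unfolding eq using \<mu> \<nu> c by (simp add: suminf_add[symmetric] suminf_mult summable_add summable_mult)
  moreover have "\<bar>2 * (\<Sum>j. b j * \<mu> j * \<nu> j)\<bar> \<le> \<eta> * energy \<mu> + 1 / \<eta> * energy \<nu>"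
  proof -
    have le: "\<bar>2 * (b j * \<mu> j * \<nu> j)\<bar> \<le> \<eta> * (b j * (\<mu> j)\<^sup>2) + 1 / \<eta> * (b j * (\<nu> j)\<^sup>2)" for j
    proof -
      have sq: "(sqrt \<eta> * x)\<^sup>2 = \<eta> * x\<^sup>2" "(x / sqrt \<eta>)\<^sup>2 = x\<^sup>2 / \<eta>" for x
        using \<eta> by (simp_all add: power_mult_distrib power_divide)
      \<comment> \<open>This is \<open>2 * x * y <= x^2 + y^2\<close> with
        \<open>x = sqrt \<eta> * |\<mu> j|\<close> and
        \<open>y = |\<nu> j| / sqrt \<eta>\<close>.\<close>
      have "2 * \<bar>\<mu> j\<bar> * \<bar>\<nu> j\<bar> \<le> \<eta> * (\<mu> j)\<^sup>2 + (\<nu> j)\<^sup>2 / \<eta>"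
        using sum_squares_bound[of "sqrt \<eta> * \<bar>\<mu> j\<bar>" "\<bar>\<nu> j\<bar> / sqrt \<eta>"] \<eta> by (simp add: sq)
      from mult_left_mono[OF this b_nonneg[of j]] show ?thesis
        using b_nonneg[of j] by (simp add: abs_mult algebra_simps)
    qed
    have s: "summable (\<lambda>j. \<eta> * (b j * (\<mu> j)\<^sup>2) + 1 / \<eta> * (b j * (\<nu> j)\<^sup>2))"
      by (intro summable_add summable_mult \<mu> \<nu>)
    have "\<bar>\<Sum>j. 2 * (b j * \<mu> j * \<nu> j)\<bar> \<le> (\<Sum>j. \<eta> * (b j * (\<mu> j)\<^sup>2) + 1 / \<eta> * (b j * (\<nu> j)\<^sup>2))"
      using norm_suminf_le[OF _ s, of "\<lambda>j. 2 * (b j * \<mu> j * \<nu> j)"] le by simp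
    also have "\<dots> = \<eta> * energy \<mu> + 1 / \<eta> * energy \<nu>"
      by (simp only: suminf_add[symmetric] suminf_mult summable_mult \<mu> \<nu>)
    finally show ?thesis
      by (simp only: suminf_mult[OF c])
  qed
  ultimately show "\<bar>energy (\<lambda>j. \<mu> j + \<nu> j) - energy \<mu>\<bar> \<le> \<eta> * energy \<mu> + (1 + 1 / \<eta>) * energy \<nu>"
    using energy_nonneg[OF \<nu>] by (simp add: algebra_simps)
qed

text \<open>Almost every realisation of the noise has finite energy, so it can itself play the part
  of the second summand in \<open>energy_add\<close>.\<close>

lemma AE_summable_shifted:
  assumes \<mu>: "summable (\<lambda>j. b j * (\<mu> j)\<^sup>2)"
  shows "AE x in M. summable (\<lambda>j. b j * (\<mu> j + X j x)\<^sup>2)"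
  using AE_summable_square by eventually_elim (rule energy_add(1)[OF \<mu> _ zero_less_one])

lemma AE_shifted_form_zero: "AE x in M. shifted_form b (\<lambda>_. 0) x = chi_form b x"
  using AE_shifted_form_eq[of "\<lambda>_. 0"] by (simp add: lin_form_def)

lemma prob_shifted_form_zero_gt:
  "prob {x \<in> space M. shifted_form b (\<lambda>_. 0) x > t} = prob {x \<in> space M. chi_form b x > t}"
proof (rule finite_measure_eq_AE)
  show "AE x in M. x \<in> {x \<in> space M. shifted_form b (\<lambda>_. 0) x > t} \<longleftrightarrow> x \<in> {x \<in> space M. chi_form b x > t}"
    using AE_shifted_form_zero by eventually_elim auto
qed measurable

lemma prob_chi_form_gt_le:
  assumes "a > 0"
  shows "prob {x \<in> space M. chi_form b x > a} \<le> 2 * (\<Sum>j. (b j)\<^sup>2) / a\<^sup>2"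
  using prob_chi_form_ge_le[OF assms] by (rule order.trans[rotated]) (intro finite_measure_mono, auto)

lemma prob_chi_form_le_le:
  assumes "a > 0" "t \<le> - a"
  shows "prob {x \<in> space M. chi_form b x \<le> t} \<le> 2 * (\<Sum>j. (b j)\<^sup>2) / a\<^sup>2"
  using prob_chi_form_ge_le[OF assms(1)]
  by (rule order.trans[rotated]) (intro finite_measure_mono, use assms in auto)

text \<open>Write \<open>D\<close> for the energy. Unless the linear form reaches
  \<open>D / 4\<close> in modulus, the shift moves the statistic up by at least
  \<open>D / 2\<close>; the exceptional event has probability at most
  \<open>16 * b 0 / D\<close>.\<close>

lemma prob_shifted_form_le_le:
  assumes \<mu>: "summable (\<lambda>j. b j * (\<mu> j)\<^sup>2)" and d: "0 < d" "d \<le> energy \<mu>"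
  shows "prob {x \<in> space M. shifted_form b \<mu> x \<le> t} \<le> prob {x \<in> space M. chi_form b x \<le> t - d / 2} + 16 * b 0 / d"
proof -
  let ?D = "energy \<mu>"
  have D: "?D > 0" using d by simp
  have "prob {x \<in> space M. shifted_form b \<mu> x \<le> t}
      \<le> prob ({x \<in> space M. chi_form b x \<le> t - d / 2} \<union> {x \<in> space M. ?D / 4 \<le> \<bar>lin_form b \<mu> x\<bar>})"
  proof (rule finite_measure_mono_AE)
    show "AE x in M. x \<in> {x \<in> space M. shifted_form b \<mu> x \<le> t} \<longrightarrow>
        x \<in> {x \<in> space M. chi_form b x \<le> t - d / 2} \<union> {x \<in> space M. ?D / 4 \<le> \<bar>lin_form b \<mu> x\<bar>}"
      using AE_shifted_form_eq[OF \<mu>] by eventually_elim (use d in auto)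
  qed measurable
  also have "\<dots> \<le> prob {x \<in> space M. chi_form b x \<le> t - d / 2} + prob {x \<in> space M. ?D / 4 \<le> \<bar>lin_form b \<mu> x\<bar>}"
    by (intro measure_Un_le) auto
  also have "prob {x \<in> space M. ?D / 4 \<le> \<bar>lin_form b \<mu> x\<bar>} \<le> b 0 * ?D / (?D / 4)\<^sup>2"
    using D by (intro prob_lin_form_ge_le \<mu>) simp
  also have "\<dots> = 16 * b 0 / ?D"
    using D by (simp add: power2_eq_square)
  also have "\<dots> \<le> 16 * b 0 / d"
    using d b_nonneg[of 0] D by (intro divide_left_mono) auto
  finally show ?thesis by simp
qed

text \<open>Where both linear forms are below \<open>e / 2\<close> in modulus, they and the change
  of energy move the statistic by so little that the two decisions can differ only if the quadratic
  form lies within \<open>2 * e\<close> of \<open>t\<close> minus the energy of \<mu>. The last term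
  collects the two Chebyshev bounds for the linear forms.\<close>

lemma prob_shifted_form_diff_le:
  assumes \<mu>: "summable (\<lambda>j. b j * (\<mu> j)\<^sup>2)" and \<nu>: "summable (\<lambda>j. b j * (\<nu> j)\<^sup>2)"
    and e: "e > 0" "\<bar>energy \<nu> - energy \<mu>\<bar> \<le> e"
  shows "\<bar>prob {x \<in> space M. shifted_form b \<mu> x \<le> t} - prob {x \<in> space M. shifted_form b \<nu> x \<le> t}\<bar>
    \<le> prob {x \<in> space M. \<bar>chi_form b x - (t - energy \<mu>)\<bar> \<le> 2 * e} + 4 * b 0 * (energy \<mu> + energy \<nu>) / e\<^sup>2"
proof -
  let ?A = "\<lambda>\<mu>. {x \<in> space M. shifted_form b \<mu> x \<le> t}"
  let ?B = "{x \<in> space M. \<bar>chi_form b x - (t - energy \<mu>)\<bar> \<le> 2 * e}"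
  let ?L = "\<lambda>\<mu>. {x \<in> space M. e / 2 \<le> \<bar>lin_form b \<mu> x\<bar>}"
  let ?E = "?B \<union> (?L \<mu> \<union> ?L \<nu>)"
  have near: "\<bar>z - (t - m)\<bar> \<le> 2 * e"
    if "z + 2 * k + m \<le> t \<and> \<not> z + 2 * l + n \<le> t \<or> z + 2 * l + n \<le> t \<and> \<not> z + 2 * k + m \<le> t"
      "\<not> e / 2 \<le> \<bar>k\<bar>" "\<not> e / 2 \<le> \<bar>l\<bar>" "\<bar>n - m\<bar> \<le> e" for z k l m n :: real
    using that e(1) by linarith
  have incl: "AE x in M. x \<in> ?A \<mu> \<longrightarrow> x \<in> ?A \<nu> \<union> ?E"
    using AE_shifted_form_eq[OF \<mu>] AE_shifted_form_eq[OF \<nu>]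
  proof eventually_elim
    case (elim x)
    show ?case
      using near[OF _ _ _ e(2), of "chi_form b x" "lin_form b \<mu> x" "lin_form b \<nu> x"] elim by auto
  qed
  have incl': "AE x in M. x \<in> ?A \<nu> \<longrightarrow> x \<in> ?A \<mu> \<union> ?E"
    using AE_shifted_form_eq[OF \<mu>] AE_shifted_form_eq[OF \<nu>]
  proof eventually_elim
    case (elim x)
    show ?case
      using near[OF _ _ _ e(2), of "chi_form b x" "lin_form b \<mu> x" "lin_form b \<nu> x"] elim by auto
  qed
  have "prob (?A \<mu>) \<le> prob (?A \<nu> \<union> ?E)"
    by (rule finite_measure_mono_AE[OF incl]) measurable
  moreover have "prob (?A \<nu>) \<le> prob (?A \<mu> \<union> ?E)"
    by (rule finite_measure_mono_AE[OF incl']) measurable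
  moreover have "prob (?A \<nu> \<union> ?E) \<le> prob (?A \<nu>) + prob ?E" "prob (?A \<mu> \<union> ?E) \<le> prob (?A \<mu>) + prob ?E"
    by (intro measure_Un_le; measurable)+
  ultimately have "\<bar>prob (?A \<mu>) - prob (?A \<nu>)\<bar> \<le> prob ?E"
    by linarith
  also have "prob ?E \<le> prob ?B + prob (?L \<mu> \<union> ?L \<nu>)"
    by (intro measure_Un_le; measurable)
  also have "prob (?L \<mu> \<union> ?L \<nu>) \<le> prob (?L \<mu>) + prob (?L \<nu>)"
    by (intro measure_Un_le; measurable)
  also have "prob (?L \<mu>) \<le> b 0 * energy \<mu> / (e / 2)\<^sup>2"
    using e by (intro prob_lin_form_ge_le \<mu>) simp
  also have "prob (?L \<nu>) \<le> b 0 * energy \<nu> / (e / 2)\<^sup>2"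
    using e by (intro prob_lin_form_ge_le \<nu>) simp
  finally have "\<bar>prob (?A \<mu>) - prob (?A \<nu>)\<bar>
      \<le> prob ?B + (b 0 * energy \<mu> / (e / 2)\<^sup>2 + b 0 * energy \<nu> / (e / 2)\<^sup>2)"
    by simp
  also have "b 0 * x / (e / 2)\<^sup>2 + b 0 * y / (e / 2)\<^sup>2 = 4 * b 0 * (x + y) / e\<^sup>2" for x y
    using e(1) by (simp add: field_simps)
  finally show ?thesis .
qed

text \<open>A pigeonhole over intervals of length \<open>h\<close> replaces the central limit theorem: the position
  \<open>t\<close> is not controlled, but inconsistency is assumed for every sequence of thresholds.\<close>

lemma chi_form_interval_prob:
  assumes a: "a > 0" "4 * (\<Sum>j. (b j)\<^sup>2) \<le> a\<^sup>2" and N: "2 * a \<le> real N * h" "N > 0"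
  obtains t where "prob {x \<in> space M. chi_form b x \<le> t} - prob {x \<in> space M. chi_form b x \<le> t - h} \<ge> 1 / (2 * real N)"
proof -
  define F where "F t = prob {x \<in> space M. chi_form b x \<le> t}" for t
  have "1 - prob {x \<in> space M. a \<le> \<bar>chi_form b x\<bar>} = prob (space M - {x \<in> space M. a \<le> \<bar>chi_form b x\<bar>})"
    by (rule prob_compl[symmetric]) measurable
  \<comment> \<open>The \<open>N\<close> intervals of length \<open>h\<close> starting at
    \<open>- a\<close> reach at least to \<open>a\<close>, so they cover the central part, which
    carries at least half of the mass.\<close>
  also have "\<dots> \<le> prob ({x \<in> space M. chi_form b x \<le> - a + real N * h} - {x \<in> space M. chi_form b x \<le> - a})"
    using N by (intro finite_measure_mono) auto
  also have "\<dots> = F (- a + real N * h) - F (- a)"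
    unfolding F_def using N a by (intro finite_measure_Diff) auto
  finally have "1 - 2 * (\<Sum>j. (b j)\<^sup>2) / a\<^sup>2 \<le> F (- a + real N * h) - F (- a)"
    using prob_chi_form_ge_le[OF a(1)] by simp
  moreover have "2 * (\<Sum>j. (b j)\<^sup>2) / a\<^sup>2 \<le> 1 / 2"
    using a by (simp add: field_simps)
  ultimately have half: "1 / 2 \<le> F (- a + real N * h) - F (- a)"
    by simp
  \<comment> \<open>The increments of \<open>F\<close> over the \<open>N\<close> intervals telescope
    to at least 1/2, so one of them is at least the average.\<close>
  have "\<exists>i<N. 1 / (2 * real N) \<le> F (- a + real (Suc i) * h) - F (- a + real i * h)"
  proof (rule ccontr)
    assume "\<not> ?thesis"
    then have "(\<Sum>i<N. F (- a + real (Suc i) * h) - F (- a + real i * h)) < (\<Sum>i<N. 1 / (2 * real N))"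
      using N by (intro sum_strict_mono) (auto simp: not_le)
    also have "\<dots> = 1 / 2"
      using N by simp
    also have "(\<Sum>i<N. F (- a + real (Suc i) * h) - F (- a + real i * h)) = F (- a + real N * h) - F (- a)"
      using sum_lessThan_telescope[of "\<lambda>i. F (- a + real i * h)" N] by simp
    finally show False
      using half by simp
  qed
  then obtain i where i: "1 / (2 * real N) \<le> F (- a + real (Suc i) * h) - F (- a + real i * h)"
    by blast
  have "- a + real i * h = - a + real (Suc i) * h - h"
    by (simp add: algebra_simps)
  from i[unfolded this F_def] show thesis
    by (rule that)
qed

end

section \<open>Limits along sequences of weights\<close>

text \<open>For each \<open>n\<close> one of two cases applies. If the energy of
  \<open>\<mu> n\<close> is at most \<open>4 * m\<close>, adding \<open>\<nu> n\<close> changes it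
  by at most \<open>e\<close> and the absence of concentration bounds the difference. Otherwise both
  energies are at least \<open>m\<close>, so far above the bounded threshold that both probabilities
  are below \<open>r\<close>.\<close>

lemma (in gaussian_noise) shifted_form_prob_diff_tendsto_0:
  assumes b: "\<And>n. n \<ge> 1 \<Longrightarrow> weighted_gaussian_noise M X (b n)"
    and b0: "(\<lambda>n. b n 0) \<longlonglongrightarrow> 0"
    and C: "0 < C1" "\<And>n. n \<ge> 1 \<Longrightarrow> C1 \<le> (\<Sum>j. (b n j)\<^sup>2)" "\<And>n. n \<ge> 1 \<Longrightarrow> (\<Sum>j. (b n j)\<^sup>2) \<le> C2"
    and \<mu>: "\<And>n. n \<ge> 1 \<Longrightarrow> summable (\<lambda>j. b n j * (\<mu> n j)\<^sup>2)"
    and \<nu>: "\<And>n. n \<ge> 1 \<Longrightarrow> summable (\<lambda>j. b n j * (\<nu> n j)\<^sup>2)"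
    and \<nu>0: "(\<lambda>n. \<Sum>j. b n j * (\<nu> n j)\<^sup>2) \<longlonglongrightarrow> 0"
    and t: "eventually (\<lambda>n. t n \<le> T) sequentially"
  shows "(\<lambda>n. prob {x \<in> space M. shifted_form (b n) (\<mu> n) x \<le> t n}
      - prob {x \<in> space M. shifted_form (b n) (\<lambda>j. \<mu> n j + \<nu> n j) x \<le> t n}) \<longlonglongrightarrow> 0"
proof (rule LIMSEQ_I)
  fix r :: real assume r: "r > 0"
  obtain s where s: "s > 0" "\<And>u. \<bar>u\<bar> \<le> s \<Longrightarrow>
      cmod (char (distr std_normal_distribution borel (\<lambda>x. x\<^sup>2 - 1)) u) \<le> exp (- u\<^sup>2 / 2)"
    by (rule char_chi_square_le) blast
  have C2: "C2 > 0"
    using C(1) C(2,3)[of 1] by linarith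
  \<comment> \<open>\<open>4 * T <= m\<close> puts \<open>t n - m / 2\<close> below
    \<open>- m / 4\<close>, so the lower tail costs at most \<open>32 * C2 / m^2\<close>. The factor
    64 makes this strictly less than \<open>r\<close>, using \<open>m <= m^2\<close>.\<close>
  define m where "m = max 1 (max (4 * T) (64 * C2 / r))"
  have m: "m > 0" "4 * T \<le> m" "32 * C2 / m\<^sup>2 < r"
  proof -
    show "m > 0" "4 * T \<le> m" by (auto simp: m_def)
    have m1: "m \<ge> 1" "64 * C2 / r \<le> m" by (auto simp: m_def)
    then have "64 * C2 \<le> r * m"
      using r by (simp add: field_simps)
    moreover have "r * m \<le> r * m\<^sup>2"
      using m1 r by (intro mult_left_mono) (auto simp: power2_eq_square)
    ultimately have "32 * C2 < r * m\<^sup>2"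
      using C2 by linarith
    then show "32 * C2 / m\<^sup>2 < r"
      using m1 by (simp add: field_simps)
  qed
  \<comment> \<open>Chosen so that the limit \<open>4 * e / sqrt C1\<close> of \<open>R2\<close>
    equals \<open>r / 2\<close>.\<close>
  define e where "e = r * sqrt C1 / 8"
  have e: "e > 0" "4 * e / sqrt C1 < r"
    using r C by (auto simp: e_def)
  \<comment> \<open>For an energy up to \<open>4 * m\<close> the term with \<eta> takes half of the
    allowed change \<open>e\<close>; the energy of \<open>\<nu> n\<close> eventually takes less than
    the other half.\<close>
  define \<eta> where "\<eta> = e / (8 * m)"
  have \<eta>: "\<eta> > 0" "\<eta> * (4 * m) = e / 2"
    using e m by (auto simp: \<eta>_def)
  \<comment> \<open>\<open>R1\<close> bounds either probability when the energy is large,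
    \<open>R2\<close> the difference when it is bounded; \<open>8 * m + e\<close> bounds the sum of
    the two energies in the latter case.\<close>
  define R1 where "R1 n = 32 * C2 / m\<^sup>2 + 16 * b n 0 / m" for n
  define R2 where "R2 n = 2 * (2 * e / sqrt C1 + (b n 0 / (2 * e * s))\<^sup>2) + 4 * b n 0 * (8 * m + e) / e\<^sup>2" for n
  have "R1 \<longlonglongrightarrow> 32 * C2 / m\<^sup>2 + 16 * 0 / m"
    unfolding R1_def by (intro tendsto_intros b0) (use m in auto)
  then have "eventually (\<lambda>n. R1 n < r) sequentially"
    using m by (intro order_tendstoD(2)[of R1]) auto
  moreover have "R2 \<longlonglongrightarrow> 2 * (2 * e / sqrt C1 + (0 / (2 * e * s))\<^sup>2) + 4 * 0 * (8 * m + e) / e\<^sup>2"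
    unfolding R2_def by (intro tendsto_intros b0) (use e s in auto)
  then have "eventually (\<lambda>n. R2 n < r) sequentially"
    using e by (intro order_tendstoD(2)[of R2]) auto
  moreover have "eventually (\<lambda>n. (\<Sum>j. b n j * (\<nu> n j)\<^sup>2) < m / 3) sequentially"
    using m by (intro order_tendstoD(2)[OF \<nu>0]) auto
  moreover have "eventually (\<lambda>n. (1 + 1 / \<eta>) * (\<Sum>j. b n j * (\<nu> n j)\<^sup>2) < e / 2) sequentially"
    using e by (intro order_tendstoD(2)[OF tendsto_mult_right_zero[OF \<nu>0]]) auto
  ultimately have "eventually (\<lambda>n. norm (prob {x \<in> space M. shifted_form (b n) (\<mu> n) x \<le> t n}
      - prob {x \<in> space M. shifted_form (b n) (\<lambda>j. \<mu> n j + \<nu> n j) x \<le> t n} - 0) < r) sequentially"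
    using t eventually_ge_at_top[of 1]
  proof eventually_elim
    case (elim n)
    interpret W: weighted_gaussian_noise M X "b n"
      by (rule b) fact
    note \<mu>' = \<mu>[OF elim(6)] and \<nu>' = \<nu>[OF elim(6)]
    note add = W.energy_add[OF \<mu>' \<nu>']
    note B = C(2,3)[OF elim(6)]
    let ?p = "\<lambda>\<mu>. prob {x \<in> space M. shifted_form (b n) \<mu> x \<le> t n}"
    let ?D = "W.energy (\<mu> n)" and ?D' = "W.energy (\<lambda>j. \<mu> n j + \<nu> n j)"
    note sum = add(1)[OF zero_less_one]
    show ?case
    proof (cases "?D \<le> 4 * m")
      case True
      have close: "\<bar>?D' - ?D\<bar> \<le> e"
        using add(2)[OF \<eta>(1)] mult_left_mono[OF True, of \<eta>] \<eta> elim(4) by linarith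
      have "\<bar>?p (\<mu> n) - ?p (\<lambda>j. \<mu> n j + \<nu> n j)\<bar>
          \<le> prob {x \<in> space M. \<bar>chi_form (b n) x - (t n - ?D)\<bar> \<le> 2 * e} + 4 * b n 0 * (?D + ?D') / e\<^sup>2"
        by (rule W.prob_shifted_form_diff_le[OF \<mu>' sum e(1) close])
      also have "prob {x \<in> space M. \<bar>chi_form (b n) x - (t n - ?D)\<bar> \<le> 2 * e}
          \<le> 2 * (2 * e / sqrt (\<Sum>j. (b n j)\<^sup>2) + (b n 0 / (2 * e * s))\<^sup>2)"
        using e B C(1) by (intro W.prob_chi_form_near_le[OF s]) auto
      also have "2 * e / sqrt (\<Sum>j. (b n j)\<^sup>2) \<le> 2 * e / sqrt C1"
        using e B C(1) by (intro divide_left_mono) auto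
      also have "4 * b n 0 * (?D + ?D') / e\<^sup>2 \<le> 4 * b n 0 * (8 * m + e) / e\<^sup>2"
        using True close W.b_nonneg[of 0] by (intro divide_right_mono mult_left_mono) auto
      finally show ?thesis
        using elim(2) by (simp add: R2_def)
    next
      case False
      have half: "(1 :: real) / 2 > 0" by simp
      \<comment> \<open>With \<open>\<eta> = 1 / 2\<close> at most half of an energy above
        \<open>4 * m\<close> is lost, and then three times an energy below
        \<open>m / 3\<close>.\<close>
      have D': "m \<le> ?D'"
        using add(2)[OF half] False elim(3) by simp
      have small: "?p \<kappa> < r" if \<kappa>: "summable (\<lambda>j. b n j * (\<kappa> j)\<^sup>2)" "m \<le> W.energy \<kappa>" for \<kappa>
      proof -
        have "?p \<kappa> \<le> prob {x \<in> space M. chi_form (b n) x \<le> t n - m / 2} + 16 * b n 0 / m"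
          by (rule W.prob_shifted_form_le_le[OF \<kappa>(1) m(1) \<kappa>(2)])
        also have "prob {x \<in> space M. chi_form (b n) x \<le> t n - m / 2} \<le> 2 * (\<Sum>j. (b n j)\<^sup>2) / (m / 4)\<^sup>2"
          using m elim(5) by (intro W.prob_chi_form_le_le) auto
        also have "\<dots> \<le> 2 * C2 / (m / 4)\<^sup>2"
          using B by (intro divide_right_mono) auto
        finally show ?thesis
          using elim(1) by (simp add: R1_def power_divide)
      qed
      have "?p (\<mu> n) < r"
        using False m by (intro small \<mu>') auto
      moreover have "?p (\<lambda>j. \<mu> n j + \<nu> n j) < r"
        by (intro small sum D')
      ultimately show ?thesis
        using measure_nonneg[of M "{x \<in> space M. shifted_form (b n) (\<mu> n) x \<le> t n}"]
          measure_nonneg[of M "{x \<in> space M. shifted_form (b n) (\<lambda>j. \<mu> n j + \<nu> n j) x \<le> t n}"]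
        unfolding real_norm_def diff_0_right by linarith
    qed
  qed
  then show "\<exists>no. \<forall>n\<ge>no. norm (prob {x \<in> space M. shifted_form (b n) (\<mu> n) x \<le> t n}
      - prob {x \<in> space M. shifted_form (b n) (\<lambda>j. \<mu> n j + \<nu> n j) x \<le> t n} - 0) < r"
    by (simp add: eventually_sequentially)
qed

text \<open>Given \<open>d\<close>, thresholds are chosen at the upper end of an interval of length
  \<open>d / 2\<close> with mass at least \<open>1 / (2 * N)\<close>. An energy of at least
  \<open>d\<close> shifts this mass across the threshold, so the sum of the errors drops below 1 by
  a fixed amount, against \<open>indist\<close> for these very thresholds.\<close>

lemma (in gaussian_noise) energy_tendsto_0_of_indistinguishable:
  assumes b: "\<And>n. n \<ge> 1 \<Longrightarrow> weighted_gaussian_noise M X (b n)"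
    and b0: "(\<lambda>n. b n 0) \<longlonglongrightarrow> 0"
    and C: "\<And>n. n \<ge> 1 \<Longrightarrow> (\<Sum>j. (b n j)\<^sup>2) \<le> C2"
    and \<nu>: "\<And>n. n \<ge> 1 \<Longrightarrow> summable (\<lambda>j. b n j * (\<nu> n j)\<^sup>2)"
    and indist: "\<And>t c. c < 1 \<Longrightarrow> eventually (\<lambda>n. c < prob {x \<in> space M. shifted_form (b n) (\<lambda>_. 0) x > t n}
        + prob {x \<in> space M. shifted_form (b n) (\<nu> n) x \<le> t n}) sequentially"
  shows "(\<lambda>n. \<Sum>j. b n j * (\<nu> n j)\<^sup>2) \<longlonglongrightarrow> 0"
proof (rule LIMSEQ_I)
  fix d :: real assume d: "d > 0"
  have C2: "C2 \<ge> 0"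
    using C[of 1] suminf_nonneg[OF weighted_gaussian_noise.b_sq_summable[OF b[of 1]]] by fastforce
  define a where "a = 2 * sqrt C2 + 1"
  have a: "a > 0" "4 * C2 \<le> a\<^sup>2"
    using C2 by (auto simp: a_def power2_sum power_mult_distrib add_nonneg_pos)
  \<comment> \<open>\<open>N\<close> depends on \<open>C2\<close> and \<open>d\<close> only, so the
    gain \<open>1 / (2 * N)\<close> is uniform in \<open>n\<close>.\<close>
  define N where "N = Suc (nat \<lceil>4 * a / d\<rceil>)"
  have N: "2 * a \<le> real N * (d / 2)" "N > 0"
  proof -
    have "4 * a / d \<le> real N"
      unfolding N_def by linarith
    then show "2 * a \<le> real N * (d / 2)"
      using d by (simp add: field_simps)
  qed (simp add: N_def)
  let ?F = "\<lambda>n t. prob {x \<in> space M. chi_form (b n) x \<le> t}"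
  have "\<exists>t. ?F n t - ?F n (t - d / 2) \<ge> 1 / (2 * real N)" if n: "n \<ge> 1" for n
  proof -
    interpret W: weighted_gaussian_noise M X "b n"
      by (rule b) fact
    have "4 * (\<Sum>j. (b n j)\<^sup>2) \<le> a\<^sup>2"
      using a C[OF n] by linarith
    from W.chi_form_interval_prob[OF a(1) this N] show ?thesis
      by blast
  qed
  then have "\<forall>n. \<exists>t. n \<ge> 1 \<longrightarrow> ?F n t - ?F n (t - d / 2) \<ge> 1 / (2 * real N)"
    by blast
  from choice[OF this] obtain t where
    t: "\<And>n. n \<ge> 1 \<Longrightarrow> ?F n (t n) - ?F n (t n - d / 2) \<ge> 1 / (2 * real N)"
    by blast
  \<comment> \<open>The linear form may use up half of the gain; the other half contradicts
    indistinguishability at level \<open>1 - 1 / (4 * N)\<close>.\<close>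
  have "eventually (\<lambda>n. 16 * b n 0 / d < 1 / (4 * real N)) sequentially"
    using N tendsto_divide[OF tendsto_mult[OF tendsto_const b0, of 16] tendsto_const[of d]] d
    by (intro order_tendstoD(2)[where f = "\<lambda>n. 16 * b n 0 / d" and y = 0]) auto
  moreover have "eventually (\<lambda>n. 1 - 1 / (4 * real N) < prob {x \<in> space M. shifted_form (b n) (\<lambda>_. 0) x > t n}
        + prob {x \<in> space M. shifted_form (b n) (\<nu> n) x \<le> t n}) sequentially"
    using N by (intro indist) auto
  ultimately have "eventually (\<lambda>n. norm ((\<Sum>j. b n j * (\<nu> n j)\<^sup>2) - 0) < d) sequentially"
    using eventually_ge_at_top[of 1]
  proof eventually_elim
    case (elim n)
    interpret W: weighted_gaussian_noise M X "b n"
      by (rule b) fact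
    note \<nu>' = \<nu>[OF elim(3)]
    have "prob {x \<in> space M. shifted_form (b n) (\<lambda>_. 0) x > t n} = prob {x \<in> space M. chi_form (b n) x > t n}"
      by (rule W.prob_shifted_form_zero_gt)
    also have "\<dots> = prob (space M - {x \<in> space M. chi_form (b n) x \<le> t n})"
      by (intro arg_cong[where f = prob]) auto
    also have "\<dots> = 1 - ?F n (t n)"
      by (rule prob_compl) measurable
    finally have one: "prob {x \<in> space M. shifted_form (b n) (\<lambda>_. 0) x > t n} = 1 - ?F n (t n)" .
    have "W.energy (\<nu> n) < d"
    proof (rule ccontr)
      assume "\<not> ?thesis"
      then have "prob {x \<in> space M. shifted_form (b n) (\<nu> n) x \<le> t n} \<le> ?F n (t n - d / 2) + 16 * b n 0 / d"
        using d by (intro W.prob_shifted_form_le_le \<nu>') auto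
      then have "1 - 1 / (4 * real N) < 1 - 1 / (2 * real N) + 1 / (4 * real N)"
        using one elim(1,2) t[OF elim(3)] by linarith
      then show False
        by simp
    qed
    then show ?case
      using W.energy_nonneg[OF \<nu>'] by simp
  qed
  then show "\<exists>no. \<forall>n\<ge>no. norm ((\<Sum>j. b n j * (\<nu> n j)\<^sup>2) - 0) < d"
    by (simp add: eventually_sequentially)
qed

section \<open>The sequence model\<close>

text \<open>Independence is read off the joint law: \<open>Suc\<close> is injective, so the
  reindexed coordinates have again the product law. The shift reconciles observations numbered from
  1 with series starting at 0.\<close>

lemma gaussian_noise_Xi: "gaussian_noise Xi (\<lambda>j \<xi>. \<xi> (Suc j))"
proof -
  have N: "prob_space std_normal_distribution"
    by (rule prob_space_normal_density) simp
  interpret prob_space Xi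
    unfolding Xi_def by (intro prob_space_PiM N)
  have comp[measurable]: "(\<lambda>\<xi>. \<xi> j) \<in> borel_measurable Xi" for j
    using measurable_component_singleton[of j UNIV "\<lambda>_. std_normal_distribution"] by (simp add: Xi_def)
  have d: "distr Xi borel (\<lambda>\<xi>. \<xi> j) = std_normal_distribution" for j
  proof -
    have "distr Xi std_normal_distribution (\<lambda>\<xi>. \<xi> j) = std_normal_distribution"
      unfolding Xi_def by (rule distr_PiM_component) (auto intro: N)
    then show ?thesis
      by (metis (no_types) distr_cong sets_density sets_lborel)
  qed
  have "distr Xi (\<Pi>\<^sub>M i\<in>(UNIV :: nat set). borel) (\<lambda>\<xi>. \<lambda>i\<in>UNIV. \<xi> (Suc i))
      = distr Xi (\<Pi>\<^sub>M i\<in>(UNIV :: nat set). std_normal_distribution) (\<lambda>\<xi>. \<lambda>i\<in>UNIV. \<xi> (Suc i))"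
    by (intro distr_cong refl sets_PiM_cong) auto
  also have "\<dots> = (\<Pi>\<^sub>M i\<in>(UNIV :: nat set). std_normal_distribution)"
    unfolding Xi_def by (rule distr_PiM_reindex) (auto intro: N)
  finally have "indep_vars (\<lambda>_. borel) (\<lambda>j \<xi>. \<xi> (Suc j)) UNIV"
    by (subst indep_vars_iff_distr_eq_PiM') (auto simp: d)
  then show ?thesis
    by unfold_locales (auto simp: d)
qed

interpretation Xi: gaussian_noise Xi "\<lambda>j \<xi>. \<xi> (Suc j)"
  by (rule gaussian_noise_Xi)

text \<open>In these coordinates the statistic multiplied by \<open>n\<^sup>2 / \<sigma>\<^sup>4\<close> is the shifted form with unit noise.\<close>

definition noise_scale :: "real \<Rightarrow> nat \<Rightarrow> real" where
  "noise_scale \<sigma> n = \<sigma> / sqrt (real n)"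

text \<open>With this normalisation the sum of the squared weights is exactly the quantity bounded
  in A2.\<close>

definition scaled_weight :: "(nat \<Rightarrow> nat \<Rightarrow> real) \<Rightarrow> real \<Rightarrow> nat \<Rightarrow> nat \<Rightarrow> real" where
  "scaled_weight w \<sigma> n j = w n (Suc j) / (noise_scale \<sigma> n)\<^sup>2"

definition scaled_coef :: "(nat \<Rightarrow> real \<Rightarrow> real) \<Rightarrow> real \<Rightarrow> nat \<Rightarrow> (real \<Rightarrow> real) \<Rightarrow> nat \<Rightarrow> real" where
  "scaled_coef \<phi> \<sigma> n g j = coef \<phi> g (Suc j) / noise_scale \<sigma> n"

lemma noise_scale_pos: "\<sigma> > 0 \<Longrightarrow> n \<ge> 1 \<Longrightarrow> noise_scale \<sigma> n > 0"
  by (simp add: noise_scale_def)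

lemma Tstat_measurable[measurable]: "Tstat w \<sigma> n \<theta> \<in> borel_measurable Xi"
  unfolding Tstat_def[abs_def] by measurable

text \<open>One factor \<open>noise_scale^2\<close> comes from the weights and one from the squared
  observations. Pulling them out of the series uses its almost sure convergence.\<close>

lemma AE_Tstat_eq:
  assumes s: "\<sigma> > 0" "n \<ge> 1"
    and W: "weighted_gaussian_noise Xi (\<lambda>j \<xi>. \<xi> (Suc j)) (scaled_weight w \<sigma> n)"
    and \<theta>: "summable (\<lambda>j. scaled_weight w \<sigma> n j * (\<theta> (Suc j) / noise_scale \<sigma> n)\<^sup>2)"
  shows "AE \<xi> in Xi. Tstat w \<sigma> n \<theta> \<xi>
    = noise_scale \<sigma> n ^ 4 * Xi.shifted_form (scaled_weight w \<sigma> n) (\<lambda>j. \<theta> (Suc j) / noise_scale \<sigma> n) \<xi>"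
proof -
  interpret W: weighted_gaussian_noise Xi "\<lambda>j \<xi>. \<xi> (Suc j)" "scaled_weight w \<sigma> n"
    by (rule W)
  let ?s = "noise_scale \<sigma> n" and ?b = "scaled_weight w \<sigma> n"
  have s0: "?s > 0"
    using s by (rule noise_scale_pos)
  have w: "w n (Suc j) = ?s\<^sup>2 * ?b j" for j
    using s0 by (simp add: scaled_weight_def)
  have sq: "?s\<^sup>2 * c * (a + ?s * x)\<^sup>2 = ?s ^ 4 * (c * (a / ?s + x)\<^sup>2)" for a c x
  proof -
    have "a + ?s * x = ?s * (a / ?s + x)"
      using s0 by (simp add: field_simps)
    then show ?thesis
      by (simp only: power_mult_distrib) (simp add: power4_eq_xxxx power2_eq_square)
  qed
  have rho: "rho w n = ?s\<^sup>2 * (\<Sum>j. ?b j)"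
    unfolding rho_def w by (rule suminf_mult[OF W.b_summable])
  have s2: "\<sigma>\<^sup>2 / real n = ?s\<^sup>2"
    by (simp add: noise_scale_def power_divide)
  have s4: "?s\<^sup>2 * (?s\<^sup>2 * x) = ?s ^ 4 * x" for x
    by (simp add: power4_eq_xxxx power2_eq_square)
  show ?thesis
    using W.AE_summable_shifted[OF \<theta>]
  proof eventually_elim
    case (elim \<xi>)
    have "(\<Sum>j. w n (Suc j) * (\<theta> (Suc j) + \<sigma> / sqrt (real n) * \<xi> (Suc j))\<^sup>2)
        = ?s ^ 4 * (\<Sum>j. ?b j * (\<theta> (Suc j) / ?s + \<xi> (Suc j))\<^sup>2)"
      unfolding w noise_scale_def[symmetric] sq by (rule suminf_mult[OF elim])
    then show ?case
      by (simp only: Tstat_def Xi.shifted_form_def rho s2 s4 right_diff_distrib)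
  qed
qed

lemma type1_eq:
  assumes s: "\<sigma> > 0" "n \<ge> 1"
    and W: "weighted_gaussian_noise Xi (\<lambda>j \<xi>. \<xi> (Suc j)) (scaled_weight w \<sigma> n)"
  shows "type1 w \<sigma> n t
    = Xi.prob {\<xi> \<in> space Xi. Xi.shifted_form (scaled_weight w \<sigma> n) (\<lambda>_. 0) \<xi> > t / noise_scale \<sigma> n ^ 4}"
  unfolding type1_def
proof (rule Xi.finite_measure_eq_AE)
  have "AE \<xi> in Xi. Tstat w \<sigma> n (\<lambda>_. 0) \<xi>
      = noise_scale \<sigma> n ^ 4 * Xi.shifted_form (scaled_weight w \<sigma> n) (\<lambda>_. 0) \<xi>"
    using AE_Tstat_eq[OF s W, of "\<lambda>_. 0"] by simp
  then show "AE \<xi> in Xi. (\<xi> \<in> {\<xi> \<in> space Xi. Tstat w \<sigma> n (\<lambda>_. 0) \<xi> > t}) \<longleftrightarrow>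
      (\<xi> \<in> {\<xi> \<in> space Xi. Xi.shifted_form (scaled_weight w \<sigma> n) (\<lambda>_. 0) \<xi> > t / noise_scale \<sigma> n ^ 4})"
    by eventually_elim (use noise_scale_pos[OF s] in \<open>simp add: field_simps\<close>)
qed measurable

lemma type2_eq:
  assumes s: "\<sigma> > 0" "n \<ge> 1"
    and W: "weighted_gaussian_noise Xi (\<lambda>j \<xi>. \<xi> (Suc j)) (scaled_weight w \<sigma> n)"
    and g: "summable (\<lambda>j. scaled_weight w \<sigma> n j * (scaled_coef \<phi> \<sigma> n g j)\<^sup>2)"
  shows "type2 \<phi> w \<sigma> n t g
    = Xi.prob {\<xi> \<in> space Xi. Xi.shifted_form (scaled_weight w \<sigma> n) (scaled_coef \<phi> \<sigma> n g) \<xi> \<le> t / noise_scale \<sigma> n ^ 4}"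
  unfolding type2_def
proof (rule Xi.finite_measure_eq_AE)
  have "AE \<xi> in Xi. Tstat w \<sigma> n (coef \<phi> g) \<xi>
      = noise_scale \<sigma> n ^ 4 * Xi.shifted_form (scaled_weight w \<sigma> n) (scaled_coef \<phi> \<sigma> n g) \<xi>"
    using AE_Tstat_eq[OF s W] g unfolding scaled_coef_def[abs_def] by blast
  then show "AE \<xi> in Xi. (\<xi> \<in> {\<xi> \<in> space Xi. Tstat w \<sigma> n (coef \<phi> g) \<xi> \<le> t}) \<longleftrightarrow>
      (\<xi> \<in> {\<xi> \<in> space Xi. Xi.shifted_form (scaled_weight w \<sigma> n) (scaled_coef \<phi> \<sigma> n g) \<xi> \<le> t / noise_scale \<sigma> n ^ 4})"
    by eventually_elim (use noise_scale_pos[OF s] in \<open>simp add: field_simps\<close>)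
qed measurable

section \<open>Coefficients of square integrable functions\<close>

lemma L2_01_mult_integrable:
  assumes "L2_01 f" "L2_01 g"
  shows "set_integrable lborel {0..1} (\<lambda>t. f t * g t)"
proof -
  have [measurable]: "f \<in> borel_measurable lborel" "g \<in> borel_measurable lborel"
    using assms by (auto simp: L2_01_def)
  have "set_integrable lborel {0..1} (\<lambda>t. (f t)\<^sup>2 + (g t)\<^sup>2)"
    using assms by (auto simp: L2_01_def intro: set_integral_add)
  then show ?thesis
    unfolding set_integrable_def
  proof (rule Bochner_Integration.integrable_bound)
    show "AE x in lborel. norm (indicat_real {0..1} x *\<^sub>R (f x * g x))
        \<le> norm (indicat_real {0..1} x *\<^sub>R ((f x)\<^sup>2 + (g x)\<^sup>2))"
      using abs_mult_le_sum_squares by (auto simp: indicator_def)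
  qed measurable
qed

lemma coef_add:
  assumes "orthonormal_basis_01 \<phi>" "L2_01 f" "L2_01 g" "j \<ge> 1"
  shows "coef \<phi> (\<lambda>x. f x + g x) j = coef \<phi> f j + coef \<phi> g j"
  using assms L2_01_mult_integrable[of f "\<phi> j"] L2_01_mult_integrable[of g "\<phi> j"]
  by (simp add: coef_def ip01_def distrib_right set_integral_add(2) orthonormal_basis_01_def)

text \<open>A product is at most the sum of the squares, and the basis function has norm 1.
  Boundedness uniform in \<open>j\<close> suffices for finite energy, since the weights are
  summable.\<close>

lemma coef_bounded:
  assumes \<phi>: "orthonormal_basis_01 \<phi>" and f: "L2_01 f" and j: "j \<ge> 1"
  shows "\<bar>coef \<phi> f j\<bar> \<le> ip01 f f + 1"
proof -
  have pj: "L2_01 (\<phi> j)" "ip01 (\<phi> j) (\<phi> j) = 1"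
    using \<phi> j by (auto simp: orthonormal_basis_01_def)
  note int = L2_01_mult_integrable[OF f pj(1)] L2_01_mult_integrable[OF f f] L2_01_mult_integrable[OF pj(1) pj(1)]
  have le: "\<bar>x * y\<bar> \<le> x * x + y * y" for x y :: real
    using abs_mult_le_sum_squares[of x y] by (simp add: power2_eq_square)
  have "\<bar>coef \<phi> f j\<bar> \<le> (LINT t:{0..1}|lborel. \<bar>f t * \<phi> j t\<bar>)"
    using set_integral_norm_bound[OF int(1)] by (simp add: coef_def ip01_def)
  also have "\<dots> \<le> (LINT t:{0..1}|lborel. f t * f t + \<phi> j t * \<phi> j t)"
    using set_integrable_abs[OF int(1)] set_integral_add(1)[OF int(2,3)] by (rule set_integral_mono) (rule le)
  also have "\<dots> = ip01 f f + 1"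
    using pj(2) by (simp add: ip01_def set_integral_add(2)[OF int(2,3)])
  finally show ?thesis .
qed

lemma scaled_coef_summable:
  assumes \<phi>: "orthonormal_basis_01 \<phi>" and g: "L2_01 g"
    and W: "weighted_gaussian_noise Xi (\<lambda>j \<xi>. \<xi> (Suc j)) (scaled_weight w \<sigma> n)"
  shows "summable (\<lambda>j. scaled_weight w \<sigma> n j * (scaled_coef \<phi> \<sigma> n g j)\<^sup>2)"
proof -
  interpret W: weighted_gaussian_noise Xi "\<lambda>j \<xi>. \<xi> (Suc j)" "scaled_weight w \<sigma> n"
    by (rule W)
  let ?c = "((ip01 g g + 1) / noise_scale \<sigma> n)\<^sup>2"
  have "(scaled_coef \<phi> \<sigma> n g j)\<^sup>2 \<le> ?c" for j
    using power_mono[OF coef_bounded[OF \<phi> g, of "Suc j"], of 2]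
    by (simp add: scaled_coef_def power_divide divide_right_mono)
  then show ?thesis
    by (intro summable_comparison_test[OF _ summable_mult2[OF W.b_summable, of ?c]] exI[of _ 0] allI impI)
       (simp add: abs_mult W.b_nonneg mult_left_mono)
qed

section \<open>Size of the largest weight\<close>

text \<open>The first \<open>kn w n\<close> weights add up to at least half of
  \<open>rho w n\<close>, and by monotonicity each is at least \<open>kapn w n\<close>; hence the
  bound on their squares.\<close>

lemma kapn_rho_le:
  assumes nn: "\<And>j. w n j \<ge> 0" and sm: "summable (\<lambda>j. w n (Suc j))"
    and dec: "\<And>i j. 1 \<le> i \<Longrightarrow> i \<le> j \<Longrightarrow> w n j \<le> w n i"
    and pos: "rho w n > 0"
    and sm2: "summable (\<lambda>j. (w n (Suc j))\<^sup>2)"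
  shows "kapn w n * rho w n / 2 \<le> (\<Sum>j. (w n (Suc j))\<^sup>2)"
proof -
  let ?A = "{k. (\<Sum>j\<in>{1..<k}. w n j) \<le> rho w n / 2}"
  have S: "(\<Sum>j\<in>{1..<Suc N}. w n j) = (\<Sum>i<N. w n (Suc i))" for N
    by (simp add: sum.atLeast1_atMost_eq atLeastLessThanSuc_atLeastAtMost lessThan_Suc_atMost)
  have "(\<lambda>N. \<Sum>i<N. w n (Suc i)) \<longlonglongrightarrow> rho w n"
    unfolding rho_def by (rule summable_LIMSEQ[OF sm])
  then have "eventually (\<lambda>N. rho w n / 2 < (\<Sum>i<N. w n (Suc i))) sequentially"
    using pos by (intro order_tendstoD(1)) auto
  then obtain N0 where N0: "\<And>N. N \<ge> N0 \<Longrightarrow> rho w n / 2 < (\<Sum>i<N. w n (Suc i))"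
    by (auto simp: eventually_sequentially)
  \<comment> \<open>The partial sums converge to \<open>rho w n\<close>, which exceeds its half.
    Thus the set is finite and its supremum is a true maximum.\<close>
  have "?A \<subseteq> {..N0}"
  proof
    fix k assume k: "k \<in> ?A"
    show "k \<in> {..N0}"
    proof (cases k)
      case (Suc N)
      then have "\<not> N \<ge> N0"
        using k N0[of N] S[of N] by auto
      then show ?thesis using Suc by simp
    qed simp
  qed
  then have fin: "finite ?A"
    by (rule finite_subset) simp
  have one: "1 \<in> ?A"
    using pos by simp
  then have "?A \<noteq> {}"
    by blast
  then have kn: "kn w n = Max ?A"
    unfolding kn_def Sup_nat_def by (rule if_not_P)
  \<comment> \<open>By maximality the next index fails the inequality, and its half-open range
    contains exactly the first \<open>kn w n\<close> weights.\<close>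
  have "Suc (kn w n) \<notin> ?A"
    unfolding kn using Max_ge[OF fin] by (metis Suc_n_not_le_n)
  then have half: "rho w n / 2 \<le> (\<Sum>i<kn w n. w n (Suc i))"
    using S[of "kn w n"] by simp
  have "kapn w n * rho w n / 2 \<le> kapn w n * (\<Sum>i<kn w n. w n (Suc i))"
    using mult_left_mono[OF half, of "kapn w n"] nn by (simp add: kapn_def)
  also have "\<dots> = (\<Sum>i<kn w n. kapn w n * w n (Suc i))"
    by (rule sum_distrib_left)
  also have "\<dots> \<le> (\<Sum>i<kn w n. (w n (Suc i))\<^sup>2)"
    unfolding power2_eq_square kapn_def by (intro sum_mono mult_right_mono dec nn) auto
  also have "\<dots> \<le> (\<Sum>j. (w n (Suc j))\<^sup>2)"
    by (intro sum_le_suminf sm2) auto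
  finally show ?thesis .
qed

text \<open>By \<open>kapn_rho_le\<close>, A2 and A3, \<open>kapn w n\<close> is of order at most
  \<open>n powr (2 * r - 2)\<close>. The first weight is comparable to it, and rescaling multiplies
  by \<open>n / \<sigma>^2\<close>, leaving the exponent \<open>2 * r - 1 < 0\<close>.\<close>

lemma scaled_weight_tendsto_0:
  assumes s: "\<sigma> > 0" and r: "r < 1 / 2"
    and nn: "\<And>n j. w n j \<ge> 0" and sm: "\<And>n. n \<ge> 1 \<Longrightarrow> summable (\<lambda>j. w n (Suc j))"
    and sm2: "\<And>n. n \<ge> 1 \<Longrightarrow> summable (\<lambda>j. (w n (Suc j))\<^sup>2)"
    and dec: "\<And>n i j. n \<ge> 1 \<Longrightarrow> 1 \<le> i \<Longrightarrow> i \<le> j \<Longrightarrow> w n j \<le> w n i"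
    and C2: "\<And>n. n \<ge> 1 \<Longrightarrow> (real n)\<^sup>2 / \<sigma> ^ 4 * (\<Sum>j. (w n (Suc j))\<^sup>2) \<le> C2"
    and c1: "c1 > 0" "\<And>n. n \<ge> 1 \<Longrightarrow> c1 * real n powr (-2 * r) \<le> rho w n"
    and C: "C > 0" "\<And>n. n \<ge> 1 \<Longrightarrow> w n 1 \<le> C * kapn w n"
  shows "(\<lambda>n. scaled_weight w \<sigma> n 0) \<longlonglongrightarrow> 0"
proof (rule tendsto_sandwich[OF _ _ tendsto_const])
  define K where "K = 2 * C * C2 * \<sigma>\<^sup>2 / c1"
  show "\<forall>\<^sub>F n in sequentially. 0 \<le> scaled_weight w \<sigma> n 0"
    by (simp add: scaled_weight_def nn)
  show "\<forall>\<^sub>F n in sequentially. scaled_weight w \<sigma> n 0 \<le> K * real n powr (2 * r - 1)"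
    using eventually_ge_at_top[of 1]
  proof eventually_elim
    case (elim n)
    let ?Q = "\<Sum>j. (w n (Suc j))\<^sup>2"
    have n: "real n > 0" using elim by simp
    have p: "real n powr (-2 * r) > 0"
      using n by simp
    have rho: "rho w n > 0"
      using c1 p elim by (meson less_le_trans mult_pos_pos)
    have Q: "?Q \<le> C2 * \<sigma> ^ 4 / (real n)\<^sup>2"
      using C2[OF elim] n s by (simp add: field_simps)
    have "kapn w n \<le> 2 * ?Q / rho w n"
      using kapn_rho_le[OF nn sm[OF elim] dec[OF elim] rho sm2[OF elim]] rho by (simp add: field_simps)
    also have "\<dots> \<le> 2 * (C2 * \<sigma> ^ 4 / (real n)\<^sup>2) / (c1 * real n powr (-2 * r))"
      using Q c1(2)[OF elim] c1(1) p rho suminf_nonneg[OF sm2[OF elim]] by (intro frac_le) auto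
    finally have kap: "kapn w n \<le> 2 * (C2 * \<sigma> ^ 4 / (real n)\<^sup>2) / (c1 * real n powr (-2 * r))" .
    have "scaled_weight w \<sigma> n 0 = real n / \<sigma>\<^sup>2 * w n 1"
      using n s by (simp add: scaled_weight_def noise_scale_def power_divide)
    also have "\<dots> \<le> real n / \<sigma>\<^sup>2 * (C * (2 * (C2 * \<sigma> ^ 4 / (real n)\<^sup>2) / (c1 * real n powr (-2 * r))))"
      using C(2)[OF elim] mult_left_mono[OF kap, of C] C(1) by (intro mult_left_mono) auto
    also have "\<dots> = K * (1 / (real n * real n powr (-2 * r)))"
      using n s c1(1) p by (simp add: K_def field_simps power2_eq_square power4_eq_xxxx)
    also have "1 / (real n * real n powr (-2 * r)) = real n powr (2 * r - 1)"
      using n by (simp add: powr_diff powr_minus field_simps)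
    finally show ?case .
  qed
  have "(\<lambda>n. real n powr (2 * r - 1)) \<longlonglongrightarrow> 0"
    using r by (intro tendsto_neg_powr filterlim_real_sequentially) auto
  then show "(\<lambda>n. K * real n powr (2 * r - 1)) \<longlonglongrightarrow> 0"
    by (rule tendsto_mult_right_zero)
qed

section \<open>Type II errors under a perturbed alternative\<close>

theorem theorem9:
  fixes \<phi> :: "nat \<Rightarrow> real \<Rightarrow> real"
    and w :: "nat \<Rightarrow> nat \<Rightarrow> real"
    and \<sigma> r :: real
    and f f1 :: "nat \<Rightarrow> real \<Rightarrow> real"
  assumes sigma: "\<sigma> > 0"
    and r: "0 < r" "r < 1/2"
    and basis: "orthonormal_basis_01 \<phi>"
    and w_nonneg: "\<And>n j. w n j \<ge> 0"
    and w_summable: "\<And>n. n \<ge> 1 \<Longrightarrow> summable (\<lambda>j. w n (Suc j))"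
    and A1: "\<And>n i j. n \<ge> 1 \<Longrightarrow> 1 \<le> i \<Longrightarrow> i \<le> j \<Longrightarrow> w n j \<le> w n i"
    and A2: "\<exists>C1 C2. 0 < C1 \<and> (\<forall>n\<ge>1.
              C1 < (real n)\<^sup>2 / \<sigma> ^ 4 * (\<Sum>j. (w n (Suc j))\<^sup>2) \<and>
              (real n)\<^sup>2 / \<sigma> ^ 4 * (\<Sum>j. (w n (Suc j))\<^sup>2) < C2)"
    and A3: "\<exists>c1 c2. 0 < c1 \<and> (\<forall>n\<ge>1.
              c1 * real n powr (-2 * r) \<le> rho w n \<and> rho w n \<le> c2 * real n powr (-2 * r))"
    and A4: "\<exists>C1 lam. C1 > 0 \<and> lam > 1 \<and> (\<forall>\<delta>>0. \<forall>n\<ge>1.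
              w n (nat \<lfloor>(1 + \<delta>) * real (kn w n)\<rfloor>) < C1 * (1 + \<delta>) powr (- lam) * kapn w n)"
    and A5a: "\<exists>c C. 0 < c \<and> 0 < C \<and> (\<forall>n\<ge>1. c * kapn w n \<le> w n 1 \<and> w n 1 \<le> C * kapn w n)"
    and A5b: "\<And>c. c > 1 \<Longrightarrow> \<exists>C>0. \<forall>n\<ge>1. w n (nat \<lfloor>c * real (kn w n)\<rfloor>) \<ge> C * kapn w n"
    and f_L2: "\<And>n. L2_01 (f n)"
    and f1_L2: "\<And>n. L2_01 (f1 n)"
    and cons: "consistent_alt \<phi> w \<sigma> f"
    and incons: "inconsistent_alt \<phi> w \<sigma> f1"
  shows "\<forall>\<alpha>. 0 < \<alpha> \<and> \<alpha> < 1 \<longrightarrow>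
           (\<forall>t :: nat \<Rightarrow> real. (\<lambda>n. type1 w \<sigma> n (t n)) \<longlonglongrightarrow> \<alpha> \<longrightarrow>
             (\<lambda>n. type2 \<phi> w \<sigma> n (t n) (f n) - type2 \<phi> w \<sigma> n (t n) (\<lambda>x. f n x + f1 n x))
               \<longlonglongrightarrow> 0)"
proof (intro allI impI, elim conjE)
  fix \<alpha> :: real and t :: "nat \<Rightarrow> real"
  assume \<alpha>: "0 < \<alpha>" and t: "(\<lambda>n. type1 w \<sigma> n (t n)) \<longlonglongrightarrow> \<alpha>"
  let ?s = "noise_scale \<sigma>" and ?b = "scaled_weight w \<sigma>"
  have W: "weighted_gaussian_noise Xi (\<lambda>j \<xi>. \<xi> (Suc j)) (?b n)" if "n \<ge> 1" for n
  proof unfold_locales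
    show "0 \<le> ?b n j" "?b n j \<le> ?b n 0" for j
      unfolding scaled_weight_def using w_nonneg A1[OF that, of 1 "Suc j"] by (simp_all add: divide_right_mono)
    show "summable (?b n)"
      unfolding scaled_weight_def[abs_def] by (rule summable_divide[OF w_summable[OF that]])
  qed
  have w_eq: "?b n j = real n / \<sigma>\<^sup>2 * w n (Suc j)" for n j
    by (simp add: scaled_weight_def noise_scale_def power_divide)
  have sq_summable: "summable (\<lambda>j. (w n (Suc j))\<^sup>2)" if "n \<ge> 1" for n
    by (rule summable_comparison_test[OF _ summable_mult[OF w_summable[OF that], of "w n 1"]])
       (auto simp: power2_eq_square w_nonneg intro!: mult_right_mono A1[OF that])
  have sq_eq: "(\<Sum>j. (?b n j)\<^sup>2) = (real n)\<^sup>2 / \<sigma> ^ 4 * (\<Sum>j. (w n (Suc j))\<^sup>2)" if "n \<ge> 1" for n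
    unfolding w_eq power_mult_distrib suminf_mult[OF sq_summable[OF that]] by (simp add: power_divide)
  obtain C1 C2 where C: "0 < C1" "\<And>n. n \<ge> 1 \<Longrightarrow> C1 \<le> (\<Sum>j. (?b n j)\<^sup>2)" "\<And>n. n \<ge> 1 \<Longrightarrow> (\<Sum>j. (?b n j)\<^sup>2) \<le> C2"
  proof -
    from A2 obtain C1 C2 where "0 < C1" and "\<forall>n\<ge>1. C1 < (real n)\<^sup>2 / \<sigma> ^ 4 * (\<Sum>j. (w n (Suc j))\<^sup>2) \<and>
        (real n)\<^sup>2 / \<sigma> ^ 4 * (\<Sum>j. (w n (Suc j))\<^sup>2) < C2"
      by blast
    then show thesis
      by (intro that[of C1 C2]) (auto simp: sq_eq intro: less_imp_le)
  qed
  have C2: "C2 > 0"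
    using C(1) C(2,3)[of 1] by linarith
  obtain c1 where c1: "c1 > 0" "\<And>n. n \<ge> 1 \<Longrightarrow> c1 * real n powr (-2 * r) \<le> rho w n"
    using A3 by blast
  obtain C5 where C5: "C5 > 0" "\<And>n. n \<ge> 1 \<Longrightarrow> w n 1 \<le> C5 * kapn w n"
    using A5a by blast
  have b0: "(\<lambda>n. ?b n 0) \<longlonglongrightarrow> 0"
    by (rule scaled_weight_tendsto_0[OF sigma r(2) w_nonneg w_summable sq_summable A1 _ c1 C5])
       (use C(3) sq_eq in auto)
  have f: "summable (\<lambda>j. ?b n j * (scaled_coef \<phi> \<sigma> n (f n) j)\<^sup>2)"
    and f1: "summable (\<lambda>j. ?b n j * (scaled_coef \<phi> \<sigma> n (f1 n) j)\<^sup>2)" if "n \<ge> 1" for n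
    by (intro scaled_coef_summable basis f_L2 f1_L2 W that)+
  have coef_sum: "scaled_coef \<phi> \<sigma> n (\<lambda>x. f n x + f1 n x)
      = (\<lambda>j. scaled_coef \<phi> \<sigma> n (f n) j + scaled_coef \<phi> \<sigma> n (f1 n) j)" for n
    by (simp add: fun_eq_iff scaled_coef_def coef_add[OF basis f_L2 f1_L2] add_divide_distrib)

  have f1_0: "(\<lambda>n. \<Sum>j. ?b n j * (scaled_coef \<phi> \<sigma> n (f1 n) j)\<^sup>2) \<longlonglongrightarrow> 0"
  proof (rule Xi.energy_tendsto_0_of_indistinguishable[OF W b0 C(3) f1])
    fix u :: "nat \<Rightarrow> real" and c :: real assume c: "c < 1"
    \<comment> \<open>Inconsistency concerns thresholds for \<open>Tstat\<close>; \<open>v\<close>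
      is the threshold which becomes \<open>u\<close> after rescaling.\<close>
    define v where "v n = u n * ?s n ^ 4" for n
    have "1 \<le> liminf (\<lambda>n. ereal (type1 w \<sigma> n (v n) + type2 \<phi> w \<sigma> n (v n) (f1 n)))"
      using incons unfolding inconsistent_alt_def by blast
    then have "eventually (\<lambda>n. ereal c < ereal (type1 w \<sigma> n (v n) + type2 \<phi> w \<sigma> n (v n) (f1 n))) sequentially"
      using c unfolding le_Liminf_iff by (metis ereal_less(3))
    then show "\<forall>\<^sub>F n in sequentially. c < Xi.prob {x \<in> space Xi. u n < Xi.shifted_form (?b n) (\<lambda>_. 0) x}
        + Xi.prob {x \<in> space Xi. Xi.shifted_form (?b n) (scaled_coef \<phi> \<sigma> n (f1 n)) x \<le> u n}"
      using eventually_ge_at_top[of 1]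
    proof eventually_elim
      case (elim n)
      have "v n / ?s n ^ 4 = u n"
        using noise_scale_pos[OF sigma elim(2)] by (simp add: v_def)
      then show ?case
        using elim(1) by (simp add: type1_eq[OF sigma elim(2) W[OF elim(2)]]
            type2_eq[OF sigma elim(2) W[OF elim(2)] f1[OF elim(2)]])
    qed
  qed

  \<comment> \<open>A rescaled threshold above \<open>T\<close> would have type I error at most
    \<open>2 * C2 / T\<close>, hence at most \<open>\<alpha> / 2\<close>, by Chebyshev;
    \<open>T >= 1\<close> allows the squared threshold to be bounded below by
    \<open>T\<close>.\<close>
  define T where "T = max 1 (4 * C2 / \<alpha>)"
  have T: "T \<ge> 1" "4 * C2 \<le> \<alpha> * T"
    using \<alpha> by (auto simp: T_def max_def field_simps)
  have "eventually (\<lambda>n. \<alpha> / 2 < type1 w \<sigma> n (t n)) sequentially"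
    using \<alpha> by (intro order_tendstoD(1)[OF t]) auto
  then have bdd: "eventually (\<lambda>n. t n / ?s n ^ 4 \<le> T) sequentially"
    using eventually_ge_at_top[of 1]
  proof eventually_elim
    case (elim n)
    interpret W: weighted_gaussian_noise Xi "\<lambda>j \<xi>. \<xi> (Suc j)" "?b n"
      by (rule W) fact
    let ?t = "t n / ?s n ^ 4"
    show ?case
    proof (rule ccontr)
      assume "\<not> ?thesis"
      then have tT: "?t > T" by simp
      have "type1 w \<sigma> n (t n) = Xi.prob {\<xi> \<in> space Xi. Xi.chi_form (?b n) \<xi> > ?t}"
        unfolding type1_eq[OF sigma elim(2) W.weighted_gaussian_noise_axioms]
        by (rule W.prob_shifted_form_zero_gt)
      also have "\<dots> \<le> 2 * (\<Sum>j. (?b n j)\<^sup>2) / ?t\<^sup>2"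
        using tT T by (intro W.prob_chi_form_gt_le) linarith
      also have "\<dots> \<le> 2 * C2 / T"
      proof (rule frac_le)
        have "T * 1 \<le> ?t * ?t"
          using tT T by (intro mult_mono) linarith+
        then show "T \<le> ?t\<^sup>2"
          by (simp add: power2_eq_square)
      qed (use C2 T C(3)[OF elim(2)] in auto)
      also have "\<dots> \<le> \<alpha> / 2"
        using T by (simp add: field_simps)
      finally show False
        using elim(1) by simp
    qed
  qed

  have "(\<lambda>n. Xi.prob {\<xi> \<in> space Xi. Xi.shifted_form (?b n) (scaled_coef \<phi> \<sigma> n (f n)) \<xi> \<le> t n / ?s n ^ 4}
      - Xi.prob {\<xi> \<in> space Xi. Xi.shifted_form (?b n)
          (\<lambda>j. scaled_coef \<phi> \<sigma> n (f n) j + scaled_coef \<phi> \<sigma> n (f1 n) j) \<xi> \<le> t n / ?s n ^ 4}) \<longlonglongrightarrow> 0"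
    by (rule Xi.shifted_form_prob_diff_tendsto_0[OF W b0 C f f1 f1_0 bdd])
  then show "(\<lambda>n. type2 \<phi> w \<sigma> n (t n) (f n) - type2 \<phi> w \<sigma> n (t n) (\<lambda>x. f n x + f1 n x)) \<longlonglongrightarrow> 0"
  \<comment> \<open>The errors agree with the probabilities of the rescaled forms from
    \<open>n = 1\<close> on, where the noise scale is positive.\<close>
  proof (rule Lim_transform_eventually)
    show "\<forall>\<^sub>F n in sequentially.
      Xi.prob {\<xi> \<in> space Xi. Xi.shifted_form (?b n) (scaled_coef \<phi> \<sigma> n (f n)) \<xi> \<le> t n / ?s n ^ 4}
      - Xi.prob {\<xi> \<in> space Xi. Xi.shifted_form (?b n)
          (\<lambda>j. scaled_coef \<phi> \<sigma> n (f n) j + scaled_coef \<phi> \<sigma> n (f1 n) j) \<xi> \<le> t n / ?s n ^ 4}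
      = type2 \<phi> w \<sigma> n (t n) (f n) - type2 \<phi> w \<sigma> n (t n) (\<lambda>x. f n x + f1 n x)"
      using eventually_ge_at_top[of 1]
    proof eventually_elim
      case (elim n)
      have "summable (\<lambda>j. ?b n j * (scaled_coef \<phi> \<sigma> n (\<lambda>x. f n x + f1 n x) j)\<^sup>2)"
        unfolding coef_sum
        by (rule weighted_gaussian_noise.energy_add(1)[OF W[OF elim] f[OF elim] f1[OF elim] zero_less_one])
      then show ?case
        using type2_eq[OF sigma elim W[OF elim] f[OF elim]]
          type2_eq[OF sigma elim W[OF elim], of \<phi> "\<lambda>x. f n x + f1 n x"]
        by (simp add: coef_sum)
    qed
  qed
qed

end
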